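(* Let $\mu=(\mu_{jk})_{j,k\in\mathbb{Z}}$ be a matrix with $\mu_{jk}=1$ for $j\ge k$ and $\mu_{jk}\in\{-1,1\}$ for $j<k$, and assume that $\mu$ is constant on its diagonals, i.e. $\mu_{jk}=\mu_{j+n,k+n}$ for all $j<k$ and $n\in\mathbb{Z}$. Let $\mu_n$ ($n\ge1$) be the entry on the $n$-th diagonal, i.e. $\mu_n=\mu_{0,n}$, and let $X_\mu=\{n\ge1:\mu_n=-1\}$. Let $\sigma_\mu$ be the 2-cocycle on $\bigoplus_{\mathbb{Z}}\mathbb{Z}_2$ given by $\sigma_\mu((s_j)_j,(t_j)_j)=\prod_{j<k}\mu_{jk}^{s_jt_k}$, and let $\check\sigma_\mu$ be the 2-cocycle on the lamplighter group $\mathbb{Z}_2\wr\mathbb{Z}$ given by $\check\sigma_\mu\big(((s_j)_j,n),((t_j)_j,n')\big)=\sigma_\mu\big((s_j)_j,n\cdot(t_j)_j\big)$. Then $(\mathbb{Z}_2\wr\mathbb{Z},\check\sigma_\mu)$ has the unique trace property if and only if $X_\mu$ is nonperiodic, which implies that $(\mathbb{Z}_2\wr\mathbb{Z},\check\sigma_\mu)$ is $C^*$-simple.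
   Context: $\mathbb{Z}_2=\mathbb{Z}/2\mathbb{Z}$, and $\mathbb{Z}_2\wr\mathbb{Z}$ is the semidirect product $(\bigoplus_{\mathbb{Z}}\mathbb{Z}_2)\rtimes\mathbb{Z}$ with $(n\cdot(s_j)_{j\in\mathbb{Z}})_k=s_{k-n}$. $X_\mu$ is called periodic if the set $Y_\mu=X_\mu\cup(-X_\mu)\subset\mathbb{Z}$ is periodic, i.e. if there is an integer $m\ge1$ such that $\{m+y:y\in Y_\mu\}=Y_\mu$; otherwise it is nonperiodic. For a discrete group $G$ with identity $e$, a (normalized) 2-cocycle is a map $\sigma:G\times G\to\mathbb{T}$ with $\sigma(g,e)=\sigma(e,g)=1$ and $\sigma(g,h)\sigma(gh,k)=\sigma(h,k)\sigma(g,hk)$ for all $g,h,k$. With $(\lambda_\sigma(g)\xi)(h)=\sigma(g,g^{-1}h)\xi(g^{-1}h)$ on $\ell^2(G)$, $C_r^*(G,\sigma)$ is the C$^*$-algebra generated by $\lambda_\sigma(G)$. $(G,\sigma)$ is $C^*$-simple if $C_r^*(G,\sigma)$ is simple, and has the unique trace property if $C_r^*(G,\sigma)$ has a unique tracial state. *)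

theory Defs
  imports "HOL-Analysis.Analysis" "HOL-Library.Z2" "HOL-Library.Poly_Mapping"
begin

section \<open>The Hilbert space of square-summable functions\<close>

typedef 'a ell2 = "{f :: 'a \<Rightarrow> complex. (\<lambda>x. (cmod (f x))\<^sup>2) summable_on UNIV}"
  morphisms apply_ell2 Abs_ell2
  by (rule exI[of _ "\<lambda>_. 0"]) simp

setup_lifting type_definition_ell2

lemma ell2_prod_summable:
  fixes f g :: "'a \<Rightarrow> complex"
  assumes "(\<lambda>x. (cmod (f x))\<^sup>2) summable_on UNIV" "(\<lambda>x. (cmod (g x))\<^sup>2) summable_on UNIV"
  shows "(\<lambda>x. f x * cnj (g x)) summable_on UNIV"
proof -
  have "(\<lambda>x. (cmod (f x))\<^sup>2 + (cmod (g x))\<^sup>2) summable_on UNIV"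
    using assms by (rule summable_on_add)
  moreover have "norm (f x * cnj (g x)) \<le> (cmod (f x))\<^sup>2 + (cmod (g x))\<^sup>2" for x
  proof -
    have "0 \<le> (cmod (f x) - cmod (g x))\<^sup>2" "0 \<le> (cmod (f x))\<^sup>2" "0 \<le> (cmod (g x))\<^sup>2" by simp_all
    moreover have "0 \<le> cmod (f x) * cmod (g x)" by simp
    ultimately show ?thesis unfolding power2_diff norm_mult complex_mod_cnj by linarith
  qed
  ultimately have "(\<lambda>x. norm (f x * cnj (g x))) summable_on UNIV"
    by (rule Infinite_Sum.abs_summable_on_comparison_test')
  then show ?thesis by (rule abs_summable_summable)
qed

lemma ell2_add_summable:
  fixes f g :: "'a \<Rightarrow> complex"
  assumes "(\<lambda>x. (cmod (f x))\<^sup>2) summable_on UNIV" "(\<lambda>x. (cmod (g x))\<^sup>2) summable_on UNIV"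
  shows "(\<lambda>x. (cmod (f x + g x))\<^sup>2) summable_on UNIV"
proof (rule summable_on_comparison_test)
  show "(\<lambda>x. 2 * (cmod (f x))\<^sup>2 + 2 * (cmod (g x))\<^sup>2) summable_on UNIV"
    using assms by (intro summable_on_add summable_on_cmult_right)
  show "(cmod (f x + g x))\<^sup>2 \<le> 2 * (cmod (f x))\<^sup>2 + 2 * (cmod (g x))\<^sup>2" for x
  proof -
    have "(cmod (f x + g x))\<^sup>2 \<le> (cmod (f x) + cmod (g x))\<^sup>2"
      by (intro power_mono norm_triangle_ineq) simp
    moreover have "0 \<le> (cmod (f x) - cmod (g x))\<^sup>2" by simp
    ultimately show ?thesis unfolding power2_diff power2_sum by simp
  qed
qed simp

instantiation ell2 :: (type) real_vector
begin

lift_definition zero_ell2 :: "'a ell2" is "\<lambda>_. 0" by simp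

lift_definition plus_ell2 :: "'a ell2 \<Rightarrow> 'a ell2 \<Rightarrow> 'a ell2" is "\<lambda>f g x. f x + g x"
  by (rule ell2_add_summable)

lift_definition uminus_ell2 :: "'a ell2 \<Rightarrow> 'a ell2" is "\<lambda>f x. - f x" by simp

lift_definition minus_ell2 :: "'a ell2 \<Rightarrow> 'a ell2 \<Rightarrow> 'a ell2" is "\<lambda>f g x. f x - g x"
  subgoal for f g using ell2_add_summable[of f "\<lambda>x. - g x"] by simp
  done

lift_definition scaleR_ell2 :: "real \<Rightarrow> 'a ell2 \<Rightarrow> 'a ell2" is "\<lambda>r f x. of_real r * f x"
  by (auto simp: norm_mult power_mult_distrib intro: summable_on_cmult_right)

instance
  by standard (transfer; auto simp: algebra_simps)+

end

lift_definition cinner :: "'a ell2 \<Rightarrow> 'a ell2 \<Rightarrow> complex"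
  is "\<lambda>f g. \<Sum>\<^sub>\<infinity>x. f x * cnj (g x)" .

lift_definition cscale :: "complex \<Rightarrow> 'a ell2 \<Rightarrow> 'a ell2" is "\<lambda>c f x. c * f x"
  by (auto simp: norm_mult power_mult_distrib intro: summable_on_cmult_right)

lemma cinner_self: "cinner f f = of_real (\<Sum>\<^sub>\<infinity>x. (cmod (apply_ell2 f x))\<^sup>2)"
proof -
  have "cinner f f = (\<Sum>\<^sub>\<infinity>x. of_real ((cmod (apply_ell2 f x))\<^sup>2))"
    unfolding cinner.rep_eq complex_norm_square ..
  also have "\<dots> = of_real (\<Sum>\<^sub>\<infinity>x. (cmod (apply_ell2 f x))\<^sup>2)"
  proof (rule infsumI, subst has_sum_of_real_iff)
    show "((\<lambda>x. (cmod (apply_ell2 f x))\<^sup>2) has_sum (\<Sum>\<^sub>\<infinity>x. (cmod (apply_ell2 f x))\<^sup>2)) UNIV"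
      using apply_ell2[of f] by (intro has_sum_infsum) simp
  qed
  finally show ?thesis .
qed

instantiation ell2 :: (type) real_inner
begin

definition inner_ell2 :: "'a ell2 \<Rightarrow> 'a ell2 \<Rightarrow> real"
  where "inner_ell2 f g = Re (cinner f g)"

definition norm_ell2 :: "'a ell2 \<Rightarrow> real"
  where "norm_ell2 f = sqrt (inner f f)"

definition sgn_ell2 :: "'a ell2 \<Rightarrow> 'a ell2"
  where "sgn_ell2 f = f /\<^sub>R norm f"

definition dist_ell2 :: "'a ell2 \<Rightarrow> 'a ell2 \<Rightarrow> real"
  where "dist_ell2 f g = norm (f - g)"

definition uniformity_ell2 :: "('a ell2 \<times> 'a ell2) filter"
  where "uniformity_ell2 = (INF e\<in>{0<..}. principal {(f, g). dist f g < e})"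

definition open_ell2 :: "'a ell2 set \<Rightarrow> bool"
  where "open_ell2 U \<longleftrightarrow> (\<forall>f\<in>U. \<forall>\<^sub>F (f', g) in uniformity. f' = f \<longrightarrow> g \<in> U)"

instance
proof
  fix f g h :: "'a ell2" and r :: real and U :: "'a ell2 set"
  show "norm f = sqrt (inner f f)" by (rule norm_ell2_def)
  show "sgn f = f /\<^sub>R norm f" by (rule sgn_ell2_def)
  show "dist f g = norm (f - g)" by (rule dist_ell2_def)
  show "(uniformity :: ('a ell2 \<times> 'a ell2) filter) =
      (INF e\<in>{0<..}. principal {(f, g). dist f g < e})"
    by (rule uniformity_ell2_def)
  show "open U \<longleftrightarrow> (\<forall>f\<in>U. \<forall>\<^sub>F (f', g) in uniformity. f' = f \<longrightarrow> g \<in> U)"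
    by (rule open_ell2_def)
  show "inner f g = inner g f"
  proof -
    have "cinner g f = cnj (cinner f g)"
      by transfer (simp flip: infsum_cnj add: mult.commute)
    then show ?thesis by (simp add: inner_ell2_def)
  qed
  have "cinner (f + g) h = cinner f h + cinner g h"
    by transfer (simp add: distrib_right infsum_add ell2_prod_summable)
  then show "inner (f + g) h = inner f h + inner g h"
    by (simp add: inner_ell2_def)
  have "cinner (r *\<^sub>R f) g = of_real r * cinner f g"
    by transfer (simp add: mult.assoc infsum_cmult_right ell2_prod_summable)
  then show "inner (r *\<^sub>R f) g = r * inner f g"
    by (simp add: inner_ell2_def)
  have sq: "inner f f = (\<Sum>\<^sub>\<infinity>x. (cmod (apply_ell2 f x))\<^sup>2)"
    by (simp add: inner_ell2_def cinner_self)
  then show "0 \<le> inner f f" by (simp add: infsum_nonneg)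
  show "inner f f = 0 \<longleftrightarrow> f = 0"
  proof
    assume "inner f f = 0"
    then have "(cmod (apply_ell2 f x))\<^sup>2 = 0" for x
      using apply_ell2[of f] by (intro nonneg_infsum_le_0D[of _ UNIV]) (auto simp: sq)
    then show "f = 0" by transfer auto
  next
    assume "f = 0"
    then show "inner f f = 0" unfolding sq by (simp add: zero_ell2.rep_eq)
  qed
qed

end

lemma norm_ell2: "norm f = sqrt (\<Sum>\<^sub>\<infinity>x. (cmod (apply_ell2 f x))\<^sup>2)"
  unfolding norm_ell2_def inner_ell2_def cinner_self by simp


section \<open>C*-algebras of operators\<close>

text \<open>
  The type of bounded operators \<^typ>\<open>'a ell2 \<Rightarrow>\<^sub>L 'a ell2\<close> consists of the bounded real-linear
  maps; complex linearity is imposed in \<open>cstar_subalgebra\<close> below.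
\<close>

type_synonym 'a op = "'a ell2 \<Rightarrow>\<^sub>L 'a ell2"

lift_definition cscale_id :: "complex \<Rightarrow> 'a op" is cscale
proof
  fix c :: complex and f g :: "'a ell2" and r :: real
  show "cscale c (f + g) = cscale c f + cscale c g"
    by transfer (simp add: algebra_simps)
  show "cscale c (r *\<^sub>R f) = r *\<^sub>R cscale c f"
    by transfer (simp add: algebra_simps)
  have "norm (cscale c f) = norm f * cmod c" for f :: "'a ell2"
  proof -
    have "(\<Sum>\<^sub>\<infinity>x. (cmod (apply_ell2 (cscale c f) x))\<^sup>2)
        = (\<Sum>\<^sub>\<infinity>x. (cmod c)\<^sup>2 * (cmod (apply_ell2 f x))\<^sup>2)"
      by (simp only: cscale.rep_eq norm_mult power_mult_distrib)
    also have "\<dots> = (cmod c)\<^sup>2 * (\<Sum>\<^sub>\<infinity>x. (cmod (apply_ell2 f x))\<^sup>2)"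
      by (rule infsum_cmult_right')
    finally show ?thesis
      by (simp only: norm_ell2[of f] norm_ell2[of "cscale c f"]) (simp add: real_sqrt_mult)
  qed
  then show "\<exists>K. \<forall>f::'a ell2. norm (cscale c f) \<le> norm f * K"
    by (intro exI[of _ "cmod c"]) simp
qed

definition op_cscale :: "complex \<Rightarrow> 'a op \<Rightarrow> 'a op"
  where "op_cscale c T = cscale_id c o\<^sub>L T"

definition is_adjoint :: "'a op \<Rightarrow> 'a op \<Rightarrow> bool"
  where "is_adjoint S T \<longleftrightarrow> (\<forall>\<xi> \<eta>. cinner (T \<xi>) \<eta> = cinner \<xi> (S \<eta>))"

definition op_csubspace :: "'a op set \<Rightarrow> bool"
  where "op_csubspace V \<longleftrightarrow>
    0 \<in> V \<and> (\<forall>S\<in>V. \<forall>T\<in>V. S + T \<in> V) \<and> (\<forall>c. \<forall>T\<in>V. op_cscale c T \<in> V)"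

definition cstar_subalgebra :: "'a op set \<Rightarrow> bool"
  where "cstar_subalgebra A \<longleftrightarrow>
    (\<forall>T\<in>A. \<forall>c \<xi>. T (cscale c \<xi>) = cscale c (T \<xi>)) \<and>
    op_csubspace A \<and> (\<forall>S\<in>A. \<forall>T\<in>A. S o\<^sub>L T \<in> A) \<and>
    (\<forall>T\<in>A. \<exists>S\<in>A. is_adjoint S T) \<and> closed A"

definition cstar_generated :: "'a op set \<Rightarrow> 'a op set"
  where "cstar_generated X = \<Inter>{A. cstar_subalgebra A \<and> X \<subseteq> A}"

definition closed_ideal :: "'a op set \<Rightarrow> 'a op set \<Rightarrow> bool"
  where "closed_ideal I A \<longleftrightarrow> I \<subseteq> A \<and> op_csubspace I \<and> closed I \<and>
    (\<forall>S\<in>A. \<forall>T\<in>I. S o\<^sub>L T \<in> I \<and> T o\<^sub>L S \<in> I)"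

definition simple_cstar :: "'a op set \<Rightarrow> bool"
  where "simple_cstar A \<longleftrightarrow> A \<noteq> {0} \<and> (\<forall>I. closed_ideal I A \<longrightarrow> I = {0} \<or> I = A)"

text \<open>
  For algebras containing the identity operator.  Only the values of \<open>\<tau>\<close> on \<open>A\<close> matter, so
  uniqueness has to be understood on \<open>A\<close>.
\<close>

definition tracial_state :: "'a op set \<Rightarrow> ('a op \<Rightarrow> complex) \<Rightarrow> bool"
  where "tracial_state A \<tau> \<longleftrightarrow>
    (\<forall>S\<in>A. \<forall>T\<in>A. \<tau> (S + T) = \<tau> S + \<tau> T) \<and>
    (\<forall>c. \<forall>T\<in>A. \<tau> (op_cscale c T) = c * \<tau> T) \<and>
    (\<forall>S\<in>A. \<forall>T\<in>A. is_adjoint S T \<longrightarrow> \<tau> (S o\<^sub>L T) \<in> \<real>\<^sub>\<ge>\<^sub>0) \<and>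
    \<tau> id_blinfun = 1 \<and>
    (\<forall>S\<in>A. \<forall>T\<in>A. \<tau> (S o\<^sub>L T) = \<tau> (T o\<^sub>L S))"

definition unique_tracial_state :: "'a op set \<Rightarrow> bool"
  where "unique_tracial_state A \<longleftrightarrow>
    (\<exists>\<tau>. tracial_state A \<tau> \<and> (\<forall>\<tau>'. tracial_state A \<tau>' \<longrightarrow> (\<forall>T\<in>A. \<tau>' T = \<tau> T)))"


section \<open>Reduced twisted group C*-algebras\<close>

text \<open>Groups are written additively; \<^class>\<open>group_add\<close> does not assume commutativity.\<close>

definition two_cocycle :: "('g::group_add \<Rightarrow> 'g \<Rightarrow> complex) \<Rightarrow> bool"
  where "two_cocycle \<sigma> \<longleftrightarrow>
    (\<forall>g h. cmod (\<sigma> g h) = 1) \<and> (\<forall>g. \<sigma> g 0 = 1 \<and> \<sigma> 0 g = 1) \<and>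
    (\<forall>g h k. \<sigma> g h * \<sigma> (g + h) k = \<sigma> h k * \<sigma> g (h + k))"

text \<open>
  \<^const>\<open>Abs_ell2\<close> and \<^const>\<open>Blinfun\<close> are applied to arguments in their domain as soon as
  \<open>\<sigma>\<close> takes values in the unit circle, see \<open>twisted_lreg_apply\<close> below.
\<close>

definition twisted_lreg :: "('g::group_add \<Rightarrow> 'g \<Rightarrow> complex) \<Rightarrow> 'g \<Rightarrow> 'g op"
  where "twisted_lreg \<sigma> g =
    Blinfun (\<lambda>\<xi>. Abs_ell2 (\<lambda>h. \<sigma> g (- g + h) * apply_ell2 \<xi> (- g + h)))"

lemma twisted_lreg_apply:
  fixes \<sigma> :: "'g::group_add \<Rightarrow> 'g \<Rightarrow> complex"
  assumes "two_cocycle \<sigma>"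
  shows "apply_ell2 (twisted_lreg \<sigma> g \<xi>) h = \<sigma> g (- g + h) * apply_ell2 \<xi> (- g + h)"
proof -
  define F where "F \<xi> h = \<sigma> g (- g + h) * apply_ell2 \<xi> (- g + h)" for \<xi> h
  have bij: "bij (\<lambda>h. - g + h)"
    by (rule bij_betw_byWitness[of _ "\<lambda>h. g + h"]) (auto simp flip: add.assoc)
  have norm_F: "cmod (F \<xi> h) = cmod (apply_ell2 \<xi> (- g + h))" for \<xi> h
    using assms by (simp add: F_def two_cocycle_def norm_mult)
  have "(\<lambda>h. (cmod (F \<xi> h))\<^sup>2) summable_on UNIV" for \<xi>
    unfolding norm_F using apply_ell2[of \<xi>]
      summable_on_reindex_bij_betw[OF bij, of "\<lambda>h. (cmod (apply_ell2 \<xi> h))\<^sup>2"] by simp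
  then have F: "apply_ell2 (Abs_ell2 (F \<xi>)) = F \<xi>" for \<xi>
    by (simp add: Abs_ell2_inverse)
  have norm: "norm (Abs_ell2 (F \<xi>)) = norm \<xi>" for \<xi>
    unfolding norm_ell2 F norm_F
      using infsum_reindex_bij_betw[OF bij, of "\<lambda>h. (cmod (apply_ell2 \<xi> h))\<^sup>2"] by simp
  have "bounded_linear (\<lambda>\<xi>. Abs_ell2 (F \<xi>))"
  proof
    fix \<xi> \<eta> :: "'g ell2" and r :: real
    show "Abs_ell2 (F (\<xi> + \<eta>)) = Abs_ell2 (F \<xi>) + Abs_ell2 (F \<eta>)"
      by (rule apply_ell2_inject[THEN iffD1])
        (auto simp: F plus_ell2.rep_eq F_def algebra_simps)
    show "Abs_ell2 (F (r *\<^sub>R \<xi>)) = r *\<^sub>R Abs_ell2 (F \<xi>)"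
      by (rule apply_ell2_inject[THEN iffD1])
        (auto simp: F scaleR_ell2.rep_eq F_def algebra_simps)
    show "\<exists>K. \<forall>\<xi>. norm (Abs_ell2 (F \<xi>)) \<le> norm \<xi> * K"
      by (rule exI[of _ 1]) (simp add: norm)
  qed
  moreover have "twisted_lreg \<sigma> g = Blinfun (\<lambda>\<xi>. Abs_ell2 (F \<xi>))"
    by (simp add: twisted_lreg_def F_def[abs_def])
  ultimately show ?thesis
    by (simp add: bounded_linear_Blinfun_apply F) (simp add: F_def)
qed

definition reduced_twisted_cstar :: "('g::group_add \<Rightarrow> 'g \<Rightarrow> complex) \<Rightarrow> 'g op set"
  where "reduced_twisted_cstar \<sigma> = cstar_generated (range (twisted_lreg \<sigma>))"

definition cstar_simple :: "('g::group_add \<Rightarrow> 'g \<Rightarrow> complex) \<Rightarrow> bool"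
  where "cstar_simple \<sigma> \<longleftrightarrow> simple_cstar (reduced_twisted_cstar \<sigma>)"

definition unique_trace_property :: "('g::group_add \<Rightarrow> 'g \<Rightarrow> complex) \<Rightarrow> bool"
  where "unique_trace_property \<sigma> \<longleftrightarrow> unique_tracial_state (reduced_twisted_cstar \<sigma>)"


section \<open>The lamplighter group\<close>

lift_definition shift :: "int \<Rightarrow> (int \<Rightarrow>\<^sub>0 bit) \<Rightarrow> (int \<Rightarrow>\<^sub>0 bit)" is "\<lambda>n s k. s (k - n)"
proof -
  fix n :: int and s :: "int \<Rightarrow> bit"
  assume "finite {k. s k \<noteq> 0}"
  then have "finite ((\<lambda>k. k - n) -` {k. s k \<noteq> 0})"
    by (rule finite_vimageI) (simp add: inj_def)
  then show "finite {k. s (k - n) \<noteq> 0}" by (simp only: vimage_def mem_Collect_eq)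
qed

lemma shift_0 [simp]: "shift 0 s = s"
  and shift_zero [simp]: "shift n 0 = 0"
  and shift_shift [simp]: "shift n (shift m s) = shift (n + m) s"
  and shift_add: "shift n (s + t) = shift n s + shift n t"
  and shift_uminus: "shift n (- s) = - shift n s"
  by (transfer; auto simp: algebra_simps)+

text \<open>The group of pairs \<open>(s, n)\<close> with product \<open>(s, n) (t, m) = (s + n \<cdot> t, n + m)\<close>.\<close>

datatype lamplighter = Lamp (lamps: "int \<Rightarrow>\<^sub>0 bit") (pos: int)

instantiation lamplighter :: group_add
begin

definition "0 = Lamp 0 0"

definition "g + h = Lamp (lamps g + shift (pos g) (lamps h)) (pos g + pos h)"

definition "- g = Lamp (shift (- pos g) (- lamps g)) (- pos g)"

definition "g - h = g + - h" for g h :: lamplighter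

instance
  by standard
    (simp_all add: zero_lamplighter_def plus_lamplighter_def uminus_lamplighter_def
      minus_lamplighter_def shift_add shift_uminus add.assoc)

end


section \<open>The cocycles\<close>

text \<open>
  As \<open>s\<close> and \<open>t\<close> have finite support and take values in \<open>{0, 1}\<close>, the product over all
  \<open>j < k\<close> of \<open>\<mu> j k ^ (s j * t k)\<close> is the finite product of the \<open>\<mu> j k\<close> over
  \<open>j < k\<close> with \<open>s j = t k = 1\<close>.
\<close>

definition lamp_cocycle :: "(int \<Rightarrow> int \<Rightarrow> complex) \<Rightarrow> (int \<Rightarrow>\<^sub>0 bit) \<Rightarrow> (int \<Rightarrow>\<^sub>0 bit) \<Rightarrow> complex"
  where "lamp_cocycle \<mu> s t =
    (\<Prod>(j, k)\<in>{(j, k). j < k \<and> Poly_Mapping.lookup s j = 1 \<and> Poly_Mapping.lookup t k = 1}. \<mu> j k)"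

definition lamplighter_cocycle :: "(int \<Rightarrow> int \<Rightarrow> complex) \<Rightarrow> lamplighter \<Rightarrow> lamplighter \<Rightarrow> complex"
  where "lamplighter_cocycle \<mu> g h = lamp_cocycle \<mu> (lamps g) (shift (pos g) (lamps h))"

definition neg_diagonals :: "(int \<Rightarrow> int \<Rightarrow> complex) \<Rightarrow> int set"
  where "neg_diagonals \<mu> = {n. n \<ge> 1 \<and> \<mu> 0 n = -1}"

definition periodic_diagonals :: "int set \<Rightarrow> bool"
  where "periodic_diagonals X \<longleftrightarrow> (let Y = X \<union> uminus ` X in \<exists>m\<ge>1. (\<lambda>y. m + y) ` Y = Y)"

definition lamp_factor :: "(int \<Rightarrow> int \<Rightarrow> complex) \<Rightarrow> int \<Rightarrow> int \<Rightarrow> bit \<Rightarrow> bit \<Rightarrow> complex"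
  where "lamp_factor \<mu> j k a b = (if j < k \<and> a = 1 \<and> b = 1 then \<mu> j k else 1)"

lemma lamp_cocycle_over:
  assumes "finite F" "Poly_Mapping.keys s \<subseteq> F" "Poly_Mapping.keys t \<subseteq> F"
  shows "lamp_cocycle \<mu> s t = (\<Prod>(j, k)\<in>F \<times> F.
    lamp_factor \<mu> j k (Poly_Mapping.lookup s j) (Poly_Mapping.lookup t k))"
proof -
  have "{(j, k). j < k \<and> Poly_Mapping.lookup s j = 1 \<and> Poly_Mapping.lookup t k = 1} \<subseteq> F \<times> F"
    using assms(2,3) by (force simp: Poly_Mapping.keys.rep_eq)
  then show ?thesis
    unfolding lamp_cocycle_def using assms(1)
    by (intro prod.mono_neutral_cong_left) (auto simp: lamp_factor_def split: if_splits)
qed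

lemma lamp_cocycle_shift:
  assumes "\<And>j k n. j < k \<Longrightarrow> \<mu> j k = \<mu> (j + n) (k + n)"
  shows "lamp_cocycle \<mu> (shift n s) (shift n t) = lamp_cocycle \<mu> s t"
proof -
  have "\<mu> (j - n) (k - n) = \<mu> j k" if "j < k" for j k
    using assms[of "j - n" "k - n" n] that by simp
  then show ?thesis
    unfolding lamp_cocycle_def
    by (intro prod.reindex_bij_witness[of _ "\<lambda>(j, k). (j + n, k + n)" "\<lambda>(j, k). (j - n, k - n)"])
      (auto simp: shift.rep_eq)
qed

lemma lamp_cocycle_bicharacter:
  assumes "\<And>j k. j < k \<Longrightarrow> \<mu> j k \<in> {-1, 1}"
  shows "lamp_cocycle \<mu> (s + s') t = lamp_cocycle \<mu> s t * lamp_cocycle \<mu> s' t"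
    and "lamp_cocycle \<mu> t (s + s') = lamp_cocycle \<mu> t s * lamp_cocycle \<mu> t s'"
proof -
  define F where "F = Poly_Mapping.keys s \<union> Poly_Mapping.keys s' \<union> Poly_Mapping.keys t"
  have F: "finite F" "Poly_Mapping.keys s \<subseteq> F" "Poly_Mapping.keys s' \<subseteq> F" "Poly_Mapping.keys t \<subseteq> F"
    "Poly_Mapping.keys (s + s') \<subseteq> F"
    using Poly_Mapping.keys_add[of s s'] by (auto simp: F_def)
  have "\<mu> j k * \<mu> j k = 1" if "j < k" for j k
    using assms[OF that] by auto
  then have "lamp_factor \<mu> j k (a + a') b = lamp_factor \<mu> j k a b * lamp_factor \<mu> j k a' b"
      "lamp_factor \<mu> j k b (a + a') = lamp_factor \<mu> j k b a * lamp_factor \<mu> j k b a'" for j k a a' b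
    by (cases a; cases a'; simp add: lamp_factor_def)+
  then show "lamp_cocycle \<mu> (s + s') t = lamp_cocycle \<mu> s t * lamp_cocycle \<mu> s' t"
    and "lamp_cocycle \<mu> t (s + s') = lamp_cocycle \<mu> t s * lamp_cocycle \<mu> t s'"
    using F by (simp_all add: lamp_cocycle_over[of F] lookup_add case_prod_unfold prod.distrib)
qed

lemma two_cocycle_lamplighter_cocycle:
  assumes sign: "\<And>j k. j < k \<Longrightarrow> \<mu> j k \<in> {-1, 1}"
    and diag: "\<And>j k n. j < k \<Longrightarrow> \<mu> j k = \<mu> (j + n) (k + n)"
  shows "two_cocycle (lamplighter_cocycle \<mu>)"
proof -
  have "cmod (\<mu> j k) = 1" if "j < k" for j k
    using sign[OF that] by auto
  then have norm: "cmod (lamp_cocycle \<mu> s t) = 1" for s t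
    by (simp add: lamp_cocycle_def prod_norm[symmetric] case_prod_unfold)
  have zero: "lamp_cocycle \<mu> 0 t = 1" "lamp_cocycle \<mu> s 0 = 1" for s t
    by (simp_all add: lamp_cocycle_def)
  show ?thesis
    unfolding two_cocycle_def lamplighter_cocycle_def
  proof (intro conjI allI)
    fix g h k :: lamplighter
    have "lamp_cocycle \<mu> (shift (pos g) (lamps h)) (shift (pos g) (shift (pos h) (lamps k)))
        = lamp_cocycle \<mu> (lamps h) (shift (pos h) (lamps k))"
      by (rule lamp_cocycle_shift) (rule diag)
    then show "lamp_cocycle \<mu> (lamps g) (shift (pos g) (lamps h)) *
        lamp_cocycle \<mu> (lamps (g + h)) (shift (pos (g + h)) (lamps k)) =
        lamp_cocycle \<mu> (lamps h) (shift (pos h) (lamps k)) *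
        lamp_cocycle \<mu> (lamps g) (shift (pos g) (lamps (h + k)))"
      by (simp add: plus_lamplighter_def lamp_cocycle_bicharacter[OF sign] shift_add)
  qed (simp_all add: norm zero zero_lamplighter_def)
qed

end

theory Submission
  imports Defs
begin

text \<open>
  Write \<open>L g\<close> for the unitary generators of the reduced twisted group algebra \<open>A\<close>, and call a
  lamp configuration \<open>s\<close> together with position \<open>0\<close> a base element.  Two single lamps at distance
  \<open>d\<close> commute or anticommute according to the sign \<open>interaction d\<close>, which is \<open>-1\<close> exactly on
  \<open>X \<union> (-X)\<close>; so \<open>X\<close> is periodic iff this sign function is.
  
  If \<open>X\<close> is nonperiodic, every base element \<open>s \<noteq> 0\<close> anticommutes with some single lamp.  Otherwise
  the signs would satisfy a two-sided linear recurrence over the two-element field.  Such a sequence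
  is determined by any window of fixed length, and as there are only finitely many windows, two of
  them coincide, which makes the sequence periodic (\<open>periodic_if_recurrence\<close>).
  
  This is turned into a Dixmier-type property.  Consider convex combinations \<open>\<Phi>\<close> of the maps
  \<open>T \<mapsto> L t T L t\<^sup>*\<close> with \<open>t\<close> in the base.  They are contractions and commute with each other, so the
  operators \<open>T\<close> with \<open>inf \<parallel>\<Phi> T\<parallel> = 0\<close> form a closed subspace.  It contains \<open>L g\<close> for every
  \<open>g \<noteq> 0\<close>.  For a base element, average over an anticommuting lamp.  If \<open>g\<close> moves the
  lamplighter, let \<open>z\<close> be the mean of \<open>k\<close> conjugates \<open>x\<^sub>i\<close> of \<open>L g\<close>; the products \<open>x\<^sub>i\<^sup>* x\<^sub>j\<close> with
  \<open>i \<noteq> j\<close> are multiples of nontrivial base elements, so \<open>z\<^sup>* z - 1/k\<close> can be averaged to almost \<open>0\<close>,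
  and the Kadison--Schwarz inequality \<open>\<parallel>\<Phi> z\<parallel>\<^sup>2 \<le> \<parallel>\<Phi> (z\<^sup>* z)\<parallel>\<close> makes \<open>\<Phi> z\<close> small
  (\<open>averaged_null_of_almost_orthogonal\<close>).  Hence for every \<open>T\<close> in \<open>A\<close> the scalar \<open>\<tau> T\<close>, with
  \<open>\<tau>\<close> the canonical trace, is a norm limit of averages of \<open>T\<close>.  Every tracial state is bounded and
  invariant under averaging, so it equals \<open>\<tau>\<close>.  Every nonzero closed ideal contains some \<open>S T\<close> with
  \<open>S\<close> adjoint to \<open>T\<close> and \<open>\<tau> (S T) \<noteq> 0\<close>, because \<open>\<tau>\<close> is faithful, and it is stable under averaging,
  so it contains \<open>1\<close> (\<open>unique_trace_and_simple_if_averaged_null\<close>).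
  
  If \<open>X\<close> is periodic with period \<open>m\<close>, the configurations \<open>e a\<close> formed by \<open>a\<close> and its translate by \<open>m\<close>
  commute with the whole base.  The algebra that they span is commutative and has a translation
  invariant character; extended by \<open>0\<close> to the other group elements it gives a second tracial state.
  It is obtained as a limit of vector states, the vectors being the normalized values of the
  character on finite subgroups (\<open>tracial_state_of_character\<close>, \<open>periodic_second_trace\<close>).
\<close>

section \<open>Geometry of the Hilbert space\<close>

lemma apply_ell2_le_norm: "cmod (apply_ell2 f x) \<le> norm f"
proof -
  have "(\<Sum>\<^sub>\<infinity>y\<in>{x}. (cmod (apply_ell2 f y))\<^sup>2) \<le> (\<Sum>\<^sub>\<infinity>y. (cmod (apply_ell2 f y))\<^sup>2)"
    using apply_ell2[of f] by (intro infsum_mono_neutral) auto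
  then show ?thesis
    unfolding norm_ell2 by (simp add: real_le_rsqrt)
qed

lemma sum_le_norm_ell2:
  assumes "finite F"
  shows "(\<Sum>x\<in>F. (cmod (apply_ell2 f x))\<^sup>2) \<le> (norm f)\<^sup>2"
proof -
  have "(\<Sum>\<^sub>\<infinity>y\<in>F. (cmod (apply_ell2 f y))\<^sup>2) \<le> (\<Sum>\<^sub>\<infinity>y. (cmod (apply_ell2 f y))\<^sup>2)"
    using apply_ell2[of f] assms by (intro infsum_mono_neutral) auto
  then show ?thesis
    unfolding norm_ell2 using assms by (simp add: infsum_nonneg)
qed

text \<open>
  A Cauchy sequence converges at each coordinate, and the bound on the tails over finite sets of
  coordinates survives the pointwise limit; this gives both square summability of the limit and
  convergence in norm.  Completeness makes the space of bounded operators complete, which is used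
  for adjoints of norm limits and for the fixed point argument in \<open>selfadjoint_sqrt\<close>.
\<close>

lemma ell2_limit_of_Cauchy:
  fixes X :: "nat \<Rightarrow> 'a ell2"
  assumes "Cauchy X"
  shows "\<exists>g. X \<longlonglongrightarrow> g"
proof -
  have coord: "Cauchy (\<lambda>n. apply_ell2 (X n) x)" for x
  proof (rule metric_CauchyI)
    fix e :: real assume "e > 0"
    then obtain M where M: "\<And>m n. m \<ge> M \<Longrightarrow> n \<ge> M \<Longrightarrow> dist (X m) (X n) < e"
      using metric_CauchyD[OF assms] by blast
    have "dist (apply_ell2 (X m) x) (apply_ell2 (X n) x) \<le> dist (X m) (X n)" for m n
      using apply_ell2_le_norm[of "X m - X n" x] by (simp add: dist_norm minus_ell2.rep_eq)
    then show "\<exists>M. \<forall>m\<ge>M. \<forall>n\<ge>M. dist (apply_ell2 (X m) x) (apply_ell2 (X n) x) < e"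
      using M by (meson le_less_trans)
  qed
  define f where "f x = lim (\<lambda>n. apply_ell2 (X n) x)" for x
  have f: "(\<lambda>n. apply_ell2 (X n) x) \<longlonglongrightarrow> f x" for x
    unfolding f_def using coord[of x] Cauchy_convergent convergent_LIMSEQ_iff by blast
  have tail: "(\<Sum>x\<in>F. (cmod (apply_ell2 (X m) x - f x))\<^sup>2) \<le> e\<^sup>2"
    if "finite F" "\<And>n. n \<ge> m \<Longrightarrow> norm (X m - X n) \<le> e" for F m e
  proof (rule LIMSEQ_le_const2)
    show "(\<lambda>n. \<Sum>x\<in>F. (cmod (apply_ell2 (X m) x - apply_ell2 (X n) x))\<^sup>2)
        \<longlonglongrightarrow> (\<Sum>x\<in>F. (cmod (apply_ell2 (X m) x - f x))\<^sup>2)"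
      by (intro tendsto_intros f)
    have "(\<Sum>x\<in>F. (cmod (apply_ell2 (X m) x - apply_ell2 (X n) x))\<^sup>2) \<le> e\<^sup>2" if "n \<ge> m" for n
      using sum_le_norm_ell2[OF \<open>finite F\<close>, of "X m - X n"] \<open>\<And>n. n \<ge> m \<Longrightarrow> norm (X m - X n) \<le> e\<close>[OF that]
      by (simp add: minus_ell2.rep_eq)
        (meson norm_ge_zero order_trans power_mono)
    then show "\<exists>N. \<forall>n\<ge>N. (\<Sum>x\<in>F. (cmod (apply_ell2 (X m) x - apply_ell2 (X n) x))\<^sup>2) \<le> e\<^sup>2"
      by blast
  qed
  have eventually_small: "\<exists>M. \<forall>m\<ge>M. \<forall>n\<ge>m. norm (X m - X n) \<le> e" if "e > 0" for e
  proof -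
    obtain M where "\<forall>m\<ge>M. \<forall>n\<ge>M. dist (X m) (X n) < e"
      using metric_CauchyD[OF assms \<open>e > 0\<close>] by blast
    then show ?thesis by (intro exI[of _ M]) (force simp: dist_norm intro: less_imp_le)
  qed
  have diff: "(\<lambda>x. (cmod (apply_ell2 (X m) x - f x))\<^sup>2) summable_on UNIV"
    if "\<And>n. n \<ge> m \<Longrightarrow> norm (X m - X n) \<le> e" for m e
    by (rule nonneg_bdd_above_summable_on) (use tail[OF _ that] in \<open>auto intro!: bdd_aboveI[of _ "e\<^sup>2"]\<close>)
  obtain m0 where m0: "\<And>n. n \<ge> m0 \<Longrightarrow> norm (X m0 - X n) \<le> 1"
    using eventually_small[of 1] by auto
  have "(\<lambda>x. (cmod (apply_ell2 (X m0) x + - (apply_ell2 (X m0) x - f x)))\<^sup>2) summable_on UNIV"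
  proof (rule ell2_add_summable)
    show "(\<lambda>x. (cmod (apply_ell2 (X m0) x))\<^sup>2) summable_on UNIV"
      using apply_ell2[of "X m0"] by simp
    show "(\<lambda>x. (cmod (- (apply_ell2 (X m0) x - f x)))\<^sup>2) summable_on UNIV"
      using diff[OF m0] by (simp only: norm_minus_cancel)
  qed
  then have "(\<lambda>x. (cmod (f x))\<^sup>2) summable_on UNIV" by simp
  then have app: "apply_ell2 (Abs_ell2 f) = f" by (simp add: Abs_ell2_inverse)
  have "X \<longlonglongrightarrow> Abs_ell2 f"
  proof (rule metric_LIMSEQ_I)
    fix e :: real assume "e > 0"
    then obtain M where M: "\<And>m n. m \<ge> M \<Longrightarrow> n \<ge> m \<Longrightarrow> norm (X m - X n) \<le> e / 2"
      using eventually_small[of "e / 2"] by auto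
    have "norm (X m - Abs_ell2 f) \<le> e / 2" if "m \<ge> M" for m
    proof -
      have "(\<Sum>\<^sub>\<infinity>x. (cmod (apply_ell2 (X m) x - f x))\<^sup>2) \<le> (e / 2)\<^sup>2"
        using diff[OF M[OF that]] tail[OF _ M[OF that]] by (intro infsum_le_finite_sums) auto
      then have "sqrt (\<Sum>\<^sub>\<infinity>x. (cmod (apply_ell2 (X m) x - f x))\<^sup>2) \<le> e / 2"
        using \<open>e > 0\<close> by (intro real_le_lsqrt) auto
      then show ?thesis unfolding norm_ell2 by (simp add: minus_ell2.rep_eq app)
    qed
    then show "\<exists>no. \<forall>n\<ge>no. dist (X n) (Abs_ell2 f) < e"
      using \<open>e > 0\<close> by (intro exI[of _ M]) (force simp: dist_norm)
  qed
  then show ?thesis by blast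
qed

instance ell2 :: (type) banach
  by standard (simp add: ell2_limit_of_Cauchy convergent_def)

lemma ell2_eqI: "(\<And>x. apply_ell2 f x = apply_ell2 g x) \<Longrightarrow> f = g"
  by (metis apply_ell2_inject ext)

lemma cinner_add_left: "cinner (f + g) h = cinner f h + cinner g h"
  by transfer (simp add: distrib_right infsum_add ell2_prod_summable)

lemma cinner_commute: "cinner g f = cnj (cinner f g)"
  by transfer (simp flip: infsum_cnj add: mult.commute)

lemma cinner_add_right: "cinner h (f + g) = cinner h f + cinner h g"
  by (metis cinner_add_left cinner_commute complex_cnj_add)

lemma cinner_cscale_left: "cinner (cscale c f) g = c * cinner f g"
  by transfer (simp add: mult.assoc infsum_cmult_right ell2_prod_summable)

lemma cinner_cscale_right: "cinner f (cscale c g) = cnj c * cinner f g"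
  by (metis cinner_commute cinner_cscale_left complex_cnj_mult)

lemma scaleR_eq_cscale: "r *\<^sub>R f = cscale (of_real r) f"
  by transfer simp

lemma Im_cinner: "Im (cinner f g) = inner f (cscale \<i> g)"
  by (simp add: inner_ell2_def cinner_cscale_right)

lemma norm_cscale: "norm (cscale c f) = cmod c * norm f"
proof -
  have "(norm (cscale c f))\<^sup>2 = Re (cinner (cscale c f) (cscale c f))"
    by (simp add: power2_norm_eq_inner inner_ell2_def)
  also have "\<dots> = Re ((c * cnj c) * cinner f f)"
    by (simp add: cinner_cscale_left cinner_cscale_right mult_ac)
  also have "\<dots> = (cmod c * norm f)\<^sup>2"
    by (simp add: complex_norm_square[symmetric] power_mult_distrib power2_norm_eq_inner inner_ell2_def
        flip: of_real_power)
  finally show ?thesis by (rule power2_eq_imp_eq) simp_all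
qed

text \<open>
  The constant \<open>2\<close> comes from estimating real and imaginary part separately by the real
  Cauchy--Schwarz inequality; any constant is enough for continuity.
\<close>

lemma cmod_cinner_le: "cmod (cinner f g) \<le> norm f * norm g * 2"
proof -
  have "\<bar>Re (cinner f g)\<bar> \<le> norm f * norm g"
    using Cauchy_Schwarz_ineq2[of f g] by (simp add: inner_ell2_def)
  moreover have "\<bar>Im (cinner f g)\<bar> \<le> norm f * norm g"
    using Cauchy_Schwarz_ineq2[of f "cscale \<i> g"] by (simp add: Im_cinner norm_cscale)
  ultimately show ?thesis
    using cmod_le[of "cinner f g"] by linarith
qed

lemma bounded_bilinear_cinner: "bounded_bilinear cinner"
proof
  show "\<exists>K. \<forall>a b. cmod (cinner a b) \<le> norm a * norm b * K"
    using cmod_cinner_le by blast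
qed (simp_all add: cinner_add_left cinner_add_right scaleR_eq_cscale cinner_cscale_left
    cinner_cscale_right scaleR_conv_of_real)

lemmas cinner_zero = bounded_bilinear.zero_left[OF bounded_bilinear_cinner]
  bounded_bilinear.zero_right[OF bounded_bilinear_cinner]

lemmas tendsto_cinner = bounded_bilinear.tendsto[OF bounded_bilinear_cinner]

lemma cinner_self_norm: "cinner f f = of_real ((norm f)\<^sup>2)"
proof -
  have "norm f \<ge> 0" by simp
  then show ?thesis unfolding cinner_self norm_ell2 by (simp add: infsum_nonneg)
qed

definition delta :: "'a \<Rightarrow> 'a ell2"
  where "delta x = Abs_ell2 (\<lambda>y. if y = x then 1 else 0)"

lemma apply_delta: "apply_ell2 (delta x) y = (if y = x then 1 else 0)"
proof -
  have "(\<lambda>y. (cmod (if y = x then 1 else 0))\<^sup>2) summable_on UNIV"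
    by (rule summable_on_cong_neutral[THEN iffD1, OF _ _ _ summable_on_finite[of "{x}"]]) auto
  then show ?thesis by (simp add: delta_def Abs_ell2_inverse)
qed

lemma cinner_delta: "cinner f (delta x) = apply_ell2 f x"
proof -
  have "cinner f (delta x) = (\<Sum>\<^sub>\<infinity>y\<in>{x}. apply_ell2 f y)"
    unfolding cinner.rep_eq by (rule infsum_cong_neutral) (auto simp: apply_delta)
  then show ?thesis by simp
qed

lemma norm_delta: "norm (delta x) = 1"
proof -
  have "of_real ((norm (delta x))\<^sup>2) = (1 :: complex)"
    by (simp only: cinner_self_norm[symmetric] cinner_delta apply_delta) simp
  then show ?thesis
    by (metis norm_ge_zero of_real_eq_1_iff power2_eq_imp_eq one_power2 zero_le_one)
qed

section \<open>Complex-linear operators and adjoints\<close>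

lemma op_cscale_apply: "op_cscale c T \<xi> = cscale c (T \<xi>)"
  by (simp add: op_cscale_def cscale_id.rep_eq)

lemma cscale_cscale: "cscale c (cscale d f) = cscale (c * d) f"
  by transfer (simp add: mult.assoc)

lemma cscale_1: "cscale 1 f = f"
  by transfer simp

lemma cscale_add: "cscale c (f + g) = cscale c f + cscale c g"
  by transfer (simp add: algebra_simps)

lemma op_cscale_op_cscale: "op_cscale c (op_cscale d T) = op_cscale (c * d) T"
  by (rule blinfun_eqI) (simp add: op_cscale_apply cscale_cscale)

lemma op_cscale_1 [simp]: "op_cscale 1 T = T"
  by (rule blinfun_eqI) (simp add: op_cscale_apply cscale_1)

lemma op_cscale_of_real: "op_cscale (of_real r) T = r *\<^sub>R T"
  by (rule blinfun_eqI) (simp add: op_cscale_apply scaleR_eq_cscale blinfun.scaleR_left)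

lemma op_cscale_add: "op_cscale c (S + T) = op_cscale c S + op_cscale c T"
  by (rule blinfun_eqI) (simp add: op_cscale_apply cscale_add blinfun.add_left)

lemma op_cscale_scaleR: "op_cscale c (r *\<^sub>R T) = r *\<^sub>R op_cscale c T"
  by (simp add: op_cscale_op_cscale mult.commute flip: op_cscale_of_real)

lemma op_cscale_zero [simp]: "op_cscale c 0 = 0"
  using op_cscale_scaleR[of c 0 0] by simp

lemma op_cscale_compose_left: "op_cscale c S o\<^sub>L T = op_cscale c (S o\<^sub>L T)"
  by (rule blinfun_eqI) (simp add: op_cscale_apply)

lemma norm_op_cscale: "norm (op_cscale c T) \<le> cmod c * norm T"
  by (rule norm_blinfun_bound)
    (simp_all add: op_cscale_apply norm_cscale mult.assoc mult_left_mono norm_blinfun)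

lemma bounded_linear_op_cscale: "bounded_linear (op_cscale c)"
  by standard (use norm_op_cscale[of c] in \<open>auto simp: op_cscale_add op_cscale_scaleR mult.commute
      intro!: exI[of _ "cmod c"]\<close>)

lemmas compose_add_left = bounded_bilinear.add_left[OF bounded_bilinear_blinfun_compose]
  and compose_add_right = bounded_bilinear.add_right[OF bounded_bilinear_blinfun_compose]
  and compose_diff_left = bounded_bilinear.diff_left[OF bounded_bilinear_blinfun_compose]
  and compose_diff_right = bounded_bilinear.diff_right[OF bounded_bilinear_blinfun_compose]
  and compose_scaleR_left = bounded_bilinear.scaleR_left[OF bounded_bilinear_blinfun_compose]
  and compose_scaleR_right = bounded_bilinear.scaleR_right[OF bounded_bilinear_blinfun_compose]
  and compose_sum_left = bounded_bilinear.sum_left[OF bounded_bilinear_blinfun_compose]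
  and compose_sum_right = bounded_bilinear.sum_right[OF bounded_bilinear_blinfun_compose]
  and tendsto_compose = bounded_bilinear.tendsto[OF bounded_bilinear_blinfun_compose]

lemma compose_id [simp]: "id_blinfun o\<^sub>L T = T" "T o\<^sub>L id_blinfun = T"
  by (rule blinfun_eqI, simp)+

lemma compose_assoc: "(R o\<^sub>L S) o\<^sub>L T = R o\<^sub>L (S o\<^sub>L T)"
  by (rule blinfun_eqI) simp

text \<open>
  Operators are only real-linear by type, so pulling a complex scalar through a left factor needs
  this property of the factor.
\<close>

definition complex_linear :: "'a op \<Rightarrow> bool"
  where "complex_linear T \<longleftrightarrow> (\<forall>c \<xi>. T (cscale c \<xi>) = cscale c (T \<xi>))"

lemma op_cscale_compose_right:
  "complex_linear S \<Longrightarrow> S o\<^sub>L op_cscale c T = op_cscale c (S o\<^sub>L T)"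
  by (rule blinfun_eqI) (simp add: op_cscale_apply complex_linear_def)

lemma is_adjoint_commute: "is_adjoint S T \<longleftrightarrow> is_adjoint T S"
  unfolding is_adjoint_def by (metis cinner_commute complex_cnj_cnj)

lemma is_adjoint_add: "is_adjoint S T \<Longrightarrow> is_adjoint S' T' \<Longrightarrow> is_adjoint (S + S') (T + T')"
  by (simp add: is_adjoint_def blinfun.add_left cinner_add_left cinner_add_right)

lemma is_adjoint_op_cscale: "is_adjoint S T \<Longrightarrow> is_adjoint (op_cscale (cnj c) S) (op_cscale c T)"
  by (simp add: is_adjoint_def op_cscale_apply cinner_cscale_left cinner_cscale_right)

lemma is_adjoint_scaleR: "is_adjoint S T \<Longrightarrow> is_adjoint (r *\<^sub>R S) (r *\<^sub>R T)"
  using is_adjoint_op_cscale[of S T "of_real r"] by (simp add: op_cscale_of_real)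

lemma is_adjoint_diff: "is_adjoint S T \<Longrightarrow> is_adjoint S' T' \<Longrightarrow> is_adjoint (S - S') (T - T')"
  using is_adjoint_add[of S T "(-1) *\<^sub>R S'" "(-1) *\<^sub>R T'"] is_adjoint_scaleR[of S' T' "-1"] by simp

lemma is_adjoint_compose:
  "is_adjoint S T \<Longrightarrow> is_adjoint S' T' \<Longrightarrow> is_adjoint (S' o\<^sub>L S) (T o\<^sub>L T')"
  by (simp add: is_adjoint_def)

lemma is_adjoint_sum:
  "(\<And>i. i \<in> F \<Longrightarrow> is_adjoint (S i) (T i)) \<Longrightarrow> is_adjoint (\<Sum>i\<in>F. S i) (\<Sum>i\<in>F. T i)"
  by (induction F rule: infinite_finite_induct)
    (simp_all add: is_adjoint_add, simp_all add: is_adjoint_def cinner_zero)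

lemma is_adjoint_id: "is_adjoint id_blinfun id_blinfun"
  by (simp add: is_adjoint_def)

lemma is_adjoint_unique:
  assumes "is_adjoint S T" "is_adjoint S' T"
  shows "S = S'"
proof (rule blinfun_eqI)
  fix \<eta>
  have "cinner (S \<eta>) \<xi> = cinner (S' \<eta>) \<xi>" for \<xi>
    using assms unfolding is_adjoint_commute[of _ T] by (simp add: is_adjoint_def)
  from this[of "delta _"] show "S \<eta> = S' \<eta>" by (intro ell2_eqI) (simp add: cinner_delta)
qed

lemma is_adjoint_norm_sq: "is_adjoint S T \<Longrightarrow> (norm (T \<xi>))\<^sup>2 = inner ((S o\<^sub>L T) \<xi>) \<xi>"
  unfolding is_adjoint_commute[of S T] by (simp add: is_adjoint_def inner_ell2_def power2_norm_eq_inner)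

text \<open>
  \<open>\<parallel>S \<eta>\<parallel>\<^sup>2 = \<langle>T S \<eta>, \<eta>\<rangle> \<le> \<parallel>T\<parallel> \<parallel>S \<eta>\<parallel> \<parallel>\<eta>\<parallel>\<close>, and one factor \<open>\<parallel>S \<eta>\<parallel>\<close> cancels.
\<close>

lemma is_adjoint_norm_le:
  assumes "is_adjoint S T"
  shows "norm S \<le> norm T"
proof (rule norm_blinfun_bound)
  fix \<eta>
  have "(norm (S \<eta>))\<^sup>2 = inner (T (S \<eta>)) \<eta>"
    using is_adjoint_norm_sq[of T S \<eta>] assms by (simp add: is_adjoint_commute)
  also have "\<dots> \<le> norm (T (S \<eta>)) * norm \<eta>" by (rule norm_cauchy_schwarz)
  also have "\<dots> \<le> norm T * norm (S \<eta>) * norm \<eta>" by (intro mult_right_mono norm_blinfun) simp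
  finally have "norm (S \<eta>) * norm (S \<eta>) \<le> norm (S \<eta>) * (norm T * norm \<eta>)"
    by (simp add: power2_eq_square mult_ac)
  then show "norm (S \<eta>) \<le> norm T * norm \<eta>"
    by (cases "norm (S \<eta>) = 0") (auto simp: mult_le_cancel_left)
qed simp

lemma is_adjoint_norm: "is_adjoint S T \<Longrightarrow> norm S = norm T"
  by (metis is_adjoint_commute is_adjoint_norm_le order_antisym)

lemma tendsto_blinfun_apply: "f \<longlonglongrightarrow> T \<Longrightarrow> (\<lambda>n. blinfun_apply (f n) \<xi>) \<longlonglongrightarrow> T \<xi>"
  by (intro blinfun.tendsto tendsto_const)

lemma is_adjoint_limit:
  assumes "\<And>n. is_adjoint (f n) (g n)" "f \<longlonglongrightarrow> S" "g \<longlonglongrightarrow> T"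
  shows "is_adjoint S T"
  unfolding is_adjoint_def
proof (intro allI)
  fix \<xi> \<eta>
  have "(\<lambda>n. cinner (g n \<xi>) \<eta>) \<longlonglongrightarrow> cinner (T \<xi>) \<eta>"
    by (intro tendsto_cinner tendsto_const tendsto_blinfun_apply assms)
  moreover have "(\<lambda>n. cinner (g n \<xi>) \<eta>) \<longlonglongrightarrow> cinner \<xi> (S \<eta>)"
    using tendsto_cinner[OF tendsto_const[of \<xi>] tendsto_blinfun_apply[OF assms(2), of \<eta>]] assms(1)
    by (simp add: is_adjoint_def)
  ultimately show "cinner (T \<xi>) \<eta> = cinner \<xi> (S \<eta>)" by (rule LIMSEQ_unique)
qed

lemma complex_linear_limit:
  assumes "\<And>n. complex_linear (f n)" "f \<longlonglongrightarrow> T"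
  shows "complex_linear T"
  unfolding complex_linear_def
proof (intro allI)
  fix c \<xi>
  have "(\<lambda>n. f n (cscale c \<xi>)) \<longlonglongrightarrow> T (cscale c \<xi>)"
    using assms(2) by (rule tendsto_blinfun_apply)
  moreover have "(\<lambda>n. cscale_id c (f n \<xi>)) \<longlonglongrightarrow> cscale_id c (T \<xi>)"
    by (intro blinfun.tendsto tendsto_const assms)
  ultimately show "T (cscale c \<xi>) = cscale c (T \<xi>)"
    using assms(1) LIMSEQ_unique by (fastforce simp: complex_linear_def cscale_id.rep_eq)
qed

section \<open>Boundedness of tracial states\<close>

text \<open>
  The square root \<open>1 - y\<close> of \<open>1 - x\<close> solves \<open>y = (x + y\<^sup>2) / 2\<close>.  On the self-adjoint elements of norm
  at most \<open>1/2\<close> the right-hand side is a contraction with constant \<open>1/2\<close>, so Banach's fixed point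
  theorem replaces the functional calculus.
\<close>

lemma selfadjoint_sqrt:
  assumes A: "cstar_subalgebra A" and x: "x \<in> A" "is_adjoint x x" "norm x \<le> 1 / 2"
  obtains y where "y \<in> A" "is_adjoint y y"
    "(id_blinfun - y) o\<^sub>L (id_blinfun - y) = id_blinfun - x"
proof -
  define S where "S = {y \<in> A. is_adjoint y y \<and> norm y \<le> 1 / 2}"
  define f where "f y = (1 / 2) *\<^sub>R (x + (y o\<^sub>L y))" for y
  have scaleR: "r *\<^sub>R T \<in> A" if "T \<in> A" for r T
    using A that by (simp add: cstar_subalgebra_def op_csubspace_def flip: op_cscale_of_real)
  have "\<exists>!y\<in>S. f y = y"
  proof (rule Banach_fix[where c="1 / 2"])
    have "closed S"
      unfolding closed_sequential_limits
    proof (intro allI impI, elim conjE)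
      fix s T assume "\<forall>n. s n \<in> S" and lim: "s \<longlonglongrightarrow> T"
      then have s: "\<And>n. s n \<in> A" "\<And>n. is_adjoint (s n) (s n)" "\<And>n. norm (s n) \<le> 1 / 2"
        by (auto simp: S_def)
      have "T \<in> A"
        using A s(1) lim closed_sequentially[of A s T] by (auto simp: cstar_subalgebra_def)
      moreover have "norm T \<le> 1 / 2"
        by (rule LIMSEQ_le_const2[OF tendsto_norm[OF lim]]) (use s(3) in blast)
      ultimately show "T \<in> S"
        using is_adjoint_limit[OF s(2) lim lim] by (simp add: S_def)
    qed
    then show "complete S" by (simp add: complete_eq_closed)
    have "0 \<in> S"
      using A by (simp add: S_def cstar_subalgebra_def op_csubspace_def is_adjoint_def cinner_zero)
    then show "S \<noteq> {}" by blast
    show "f ` S \<subseteq> S"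
    proof (rule image_subsetI)
      fix y assume "y \<in> S"
      then have y: "y \<in> A" "is_adjoint y y" "norm y \<le> 1 / 2" by (auto simp: S_def)
      have "norm (y o\<^sub>L y) \<le> norm y * norm y" by (rule norm_blinfun_compose)
      also have "\<dots> \<le> 1 / 2 * (1 / 2)" using y(3) by (intro mult_mono) auto
      finally have "norm (f y) \<le> 1 / 2"
        using x(3) norm_triangle_ineq[of x "y o\<^sub>L y"] by (simp add: f_def)
      moreover have "f y \<in> A"
        using A x(1) y(1) unfolding f_def
        by (intro scaleR) (simp add: cstar_subalgebra_def op_csubspace_def)
      ultimately show "f y \<in> S"
        using x(2) y(2) by (simp add: S_def f_def is_adjoint_scaleR is_adjoint_add is_adjoint_compose)
    qed
    show "\<And>y z. y \<in> S \<Longrightarrow> z \<in> S \<Longrightarrow> dist (f y) (f z) \<le> 1 / 2 * dist y z"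
    proof -
      fix y z assume "y \<in> S" "z \<in> S"
      then have le: "norm y \<le> 1 / 2" "norm z \<le> 1 / 2" by (auto simp: S_def)
      have "f y - f z = (1 / 2) *\<^sub>R ((y o\<^sub>L (y - z)) + ((y - z) o\<^sub>L z))"
        by (simp add: f_def compose_diff_left compose_diff_right algebra_simps)
      then have "norm (f y - f z) \<le> 1 / 2 * (norm (y o\<^sub>L (y - z)) + norm ((y - z) o\<^sub>L z))"
        using norm_triangle_ineq[of "y o\<^sub>L (y - z)" "(y - z) o\<^sub>L z"] by simp
      also have "\<dots> \<le> 1 / 2 * (norm y * norm (y - z) + norm (y - z) * norm z)"
        by (intro mult_left_mono add_mono norm_blinfun_compose) simp
      also have "\<dots> \<le> 1 / 2 * (1 / 2 * norm (y - z) + norm (y - z) * (1 / 2))"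
        using le by (intro mult_left_mono add_mono mult_right_mono) auto
      finally show "dist (f y) (f z) \<le> 1 / 2 * dist y z" by (simp add: dist_norm)
    qed
  qed auto
  then obtain y where y: "y \<in> S" "f y = y" by blast
  have "2 *\<^sub>R f y = x + (y o\<^sub>L y)" by (simp add: f_def)
  then have "x = 2 *\<^sub>R y - (y o\<^sub>L y)" using y(2) by simp
  then have "(id_blinfun - y) o\<^sub>L (id_blinfun - y) = id_blinfun - x"
    by (simp add: compose_diff_left compose_diff_right scaleR_2)
  with y(1) show thesis by (intro that[of y]) (auto simp: S_def)
qed

text \<open>
  For self-adjoint \<open>x\<close> of norm at most \<open>1/2\<close> both \<open>1 - x\<close> and \<open>1 + x\<close> are squares of self-adjoint
  elements, so positivity bounds \<open>\<tau> x\<close>.  Scaling and the decomposition into self-adjoint parts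
  \<open>T = a + i b\<close> give a bound for all operators; the optimal constant \<open>1\<close> is not aimed at.
\<close>

lemma tracial_state_bounded:
  assumes A: "cstar_subalgebra A" "id_blinfun \<in> A" and \<tau>: "tracial_state A \<tau>" and T: "T \<in> A"
  shows "cmod (\<tau> T) \<le> 4 * norm T"
proof -
  have add: "\<And>S T. S \<in> A \<Longrightarrow> T \<in> A \<Longrightarrow> S + T \<in> A" and scale: "\<And>c T. T \<in> A \<Longrightarrow> op_cscale c T \<in> A"
    and zero: "0 \<in> A"
    using A(1) by (auto simp: cstar_subalgebra_def op_csubspace_def)
  have scaleR: "r *\<^sub>R T \<in> A" if "T \<in> A" for r T
    using scale[OF that] by (simp flip: op_cscale_of_real)
  have diff: "S - T \<in> A" if "S \<in> A" "T \<in> A" for S T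
    using add[OF that(1) scaleR[OF that(2), of "-1"]] by simp
  have \<tau>_add: "\<And>S T. S \<in> A \<Longrightarrow> T \<in> A \<Longrightarrow> \<tau> (S + T) = \<tau> S + \<tau> T"
    and \<tau>_scale: "\<And>c T. T \<in> A \<Longrightarrow> \<tau> (op_cscale c T) = c * \<tau> T"
    using \<tau> by (auto simp: tracial_state_def)
  have \<tau>_scaleR: "\<tau> (r *\<^sub>R T) = r * \<tau> T" if "T \<in> A" for r T
    using \<tau>_scale[OF that] by (simp flip: op_cscale_of_real)
  have small: "1 - \<tau> x \<in> \<real>\<^sub>\<ge>\<^sub>0" if x: "x \<in> A" "is_adjoint x x" "norm x \<le> 1 / 2" for x
  proof -
    obtain y where y: "y \<in> A" "is_adjoint y y" "(id_blinfun - y) o\<^sub>L (id_blinfun - y) = id_blinfun - x"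
      using selfadjoint_sqrt[OF A(1) x] .
    have "is_adjoint (id_blinfun - y) (id_blinfun - y)"
      by (intro is_adjoint_diff is_adjoint_id y)
    then have "\<tau> (id_blinfun - x) \<in> \<real>\<^sub>\<ge>\<^sub>0"
      using \<tau> diff[OF A(2) y(1)] unfolding tracial_state_def y(3)[symmetric] by blast
    moreover have "\<tau> (id_blinfun + (-1) *\<^sub>R x) = 1 - \<tau> x"
      using \<tau> \<tau>_add[OF A(2) scaleR[OF x(1)], of "-1"] \<tau>_scaleR[OF x(1), of "-1"]
      by (simp add: tracial_state_def)
    ultimately show ?thesis by simp
  qed
  have selfadj: "cmod (\<tau> x) \<le> 2 * norm x" if x: "x \<in> A" "is_adjoint x x" for x
  proof (cases "norm x = 0")
    case True
    then show ?thesis using \<tau>_scaleR[OF zero, of 0] by simp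
  next
    case False
    \<comment> \<open>The norm of \<open>r x\<close> is exactly \<open>1/2\<close>, the radius up to which square roots are available.\<close>
    define r where "r = inverse (2 * norm x)"
    have r: "r > 0" using False by (simp add: r_def)
    have le: "norm (r *\<^sub>R x) \<le> 1 / 2" "norm ((- r) *\<^sub>R x) \<le> 1 / 2"
      using r False by (auto simp: r_def)
    have "1 - r * \<tau> x \<in> \<real>\<^sub>\<ge>\<^sub>0" "1 - (- r) * \<tau> x \<in> \<real>\<^sub>\<ge>\<^sub>0"
      using small[of "r *\<^sub>R x"] small[of "(- r) *\<^sub>R x"] le x
      by (simp_all add: scaleR is_adjoint_scaleR \<tau>_scaleR flip: scaleR_minus_left)
    then have "Im (r * \<tau> x) = 0" "\<bar>Re (r * \<tau> x)\<bar> \<le> 1"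
      by (auto simp: complex_nonneg_Reals_iff)
    then have "cmod (r * \<tau> x) \<le> 1"
      using cmod_le[of "r * \<tau> x"] by linarith
    then show ?thesis
      using r False by (simp add: norm_mult norm_divide norm_inverse r_def field_simps)
  qed
  obtain S where S: "S \<in> A" "is_adjoint S T"
    using A(1) T by (auto simp: cstar_subalgebra_def)
  then have S': "is_adjoint T S" by (simp add: is_adjoint_commute)
  define a where "a = (1 / 2) *\<^sub>R (S + T)"
  define b where "b = op_cscale (- \<i> / 2) T + op_cscale (\<i> / 2) S"
  have a: "a \<in> A" "is_adjoint a a"
    using S T is_adjoint_scaleR[OF is_adjoint_add[OF S(2) S']] by (auto simp: a_def add scaleR add.commute)
  have b: "b \<in> A" "is_adjoint b b"
    using S T is_adjoint_add[OF is_adjoint_op_cscale[OF S(2), of "- \<i> / 2"]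
        is_adjoint_op_cscale[OF S', of "\<i> / 2"]]
    by (auto simp: b_def add scale add.commute)
  have nS: "norm S = norm T" by (rule is_adjoint_norm[OF S(2)])
  have na: "norm a \<le> norm T"
    using norm_triangle_ineq[of S T] by (simp add: a_def nS)
  have nb: "norm b \<le> norm T"
    using norm_triangle_ineq[of "op_cscale (- \<i> / 2) T" "op_cscale (\<i> / 2) S"]
      norm_op_cscale[of "- \<i> / 2" T] norm_op_cscale[of "\<i> / 2" S]
    by (simp add: b_def nS norm_divide)
  have "T = a + op_cscale \<i> b"
  proof -
    have "op_cscale \<i> b = (1 / 2) *\<^sub>R T + (- 1 / 2) *\<^sub>R S"
      unfolding b_def op_cscale_add op_cscale_op_cscale op_cscale_of_real[symmetric]
      by simp
    also have "a + \<dots> = (1 / 2) *\<^sub>R T + (1 / 2) *\<^sub>R T"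
      by (simp add: a_def scaleR_add_right)
    also have "\<dots> = T" by (simp flip: scaleR_add_left)
    finally show ?thesis by simp
  qed
  then have "\<tau> T = \<tau> a + \<i> * \<tau> b"
    using a b by (metis \<tau>_add \<tau>_scale scale)
  then have "cmod (\<tau> T) \<le> cmod (\<tau> a) + cmod (\<tau> b)"
    using norm_triangle_ineq[of "\<tau> a" "\<i> * \<tau> b"] by (simp add: norm_mult)
  then show ?thesis
    using selfadj[OF a] selfadj[OF b] na nb by linarith
qed

section \<open>The reduced twisted group algebra\<close>

locale twisted_group =
  fixes \<sigma> :: "'g::group_add \<Rightarrow> 'g \<Rightarrow> complex"
  assumes cocycle: "two_cocycle \<sigma>"
begin

abbreviation L :: "'g \<Rightarrow> 'g op"
  where "L \<equiv> twisted_lreg \<sigma>"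

abbreviation A :: "'g op set"
  where "A \<equiv> reduced_twisted_cstar \<sigma>"

lemmas L_apply = twisted_lreg_apply[OF cocycle]

lemma cocycle_unit: "cmod (\<sigma> g h) = 1" "\<sigma> g h * cnj (\<sigma> g h) = 1" "cnj (\<sigma> g h) * \<sigma> g h = 1"
proof -
  show *: "cmod (\<sigma> g h) = 1" using cocycle by (auto simp: two_cocycle_def)
  show **: "\<sigma> g h * cnj (\<sigma> g h) = 1" using * by (simp flip: complex_norm_square)
  show "cnj (\<sigma> g h) * \<sigma> g h = 1" using ** by (simp only: mult.commute)
qed

lemma cocycle_zero: "\<sigma> g 0 = 1" "\<sigma> 0 g = 1"
  using cocycle by (auto simp: two_cocycle_def)

lemma cocycle_assoc: "\<sigma> g h * \<sigma> (g + h) k = \<sigma> h k * \<sigma> g (h + k)"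
  using cocycle by (auto simp: two_cocycle_def)

lemma cocycle_inverse: "\<sigma> (- g) g = \<sigma> g (- g)"
  using cocycle_assoc[of g "- g" g] by (simp add: cocycle_zero)

lemma L_complex_linear: "complex_linear (L g)"
  unfolding complex_linear_def
  by (intro allI ell2_eqI) (simp add: L_apply cscale.rep_eq)

lemma L_mult: "L g o\<^sub>L L h = op_cscale (\<sigma> g h) (L (g + h))"
proof (rule blinfun_eqI, rule ell2_eqI)
  fix \<xi> k
  have "\<sigma> g h * \<sigma> (g + h) (- h + (- g + k)) = \<sigma> h (- h + (- g + k)) * \<sigma> g (- g + k)"
    using cocycle_assoc[of g h "- h + (- g + k)"] by simp
  moreover have "- (g + h) + k = - h + (- g + k)" by (simp only: minus_add add.assoc)
  ultimately show "apply_ell2 ((L g o\<^sub>L L h) \<xi>) k = apply_ell2 (op_cscale (\<sigma> g h) (L (g + h)) \<xi>) k"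
    by (simp add: L_apply op_cscale_apply cscale.rep_eq)
qed

lemma L_zero: "L 0 = id_blinfun"
  by (rule blinfun_eqI, rule ell2_eqI) (simp add: L_apply cocycle_zero)

text \<open>
  The inverse of \<open>L g\<close>, equal to its adjoint; it differs from \<open>L (- g)\<close> by a phase.
\<close>

definition L_inv :: "'g \<Rightarrow> 'g op"
  where "L_inv g = op_cscale (cnj (\<sigma> g (- g))) (L (- g))"

lemma L_L_inv: "L g o\<^sub>L L_inv g = id_blinfun"
  by (simp add: L_inv_def op_cscale_compose_right[OF L_complex_linear] L_mult
      op_cscale_op_cscale cocycle_unit L_zero)

lemma L_inv_L: "L_inv g o\<^sub>L L g = id_blinfun"
  by (simp add: L_inv_def op_cscale_compose_left L_mult
      op_cscale_op_cscale cocycle_inverse cocycle_unit L_zero)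

lemma L_delta: "L g (delta 0) = delta g"
  by (rule ell2_eqI) (auto simp: L_apply apply_delta cocycle_zero add_eq_0_iff)

lemma L_cinner: "cinner (L g \<xi>) (L g \<eta>) = cinner \<xi> \<eta>"
proof -
  have bij: "bij (\<lambda>h. - g + h)"
    by (rule bij_betw_byWitness[of _ "\<lambda>h. g + h"]) (auto simp flip: add.assoc)
  have "cinner (L g \<xi>) (L g \<eta>) = (\<Sum>\<^sub>\<infinity>h. (\<sigma> g (- g + h) * cnj (\<sigma> g (- g + h))) *
      (apply_ell2 \<xi> (- g + h) * cnj (apply_ell2 \<eta> (- g + h))))"
    unfolding cinner.rep_eq L_apply complex_cnj_mult by (simp only: mult_ac)
  also have "\<dots> = cinner \<xi> \<eta>"
    using infsum_reindex_bij_betw[OF bij, of "\<lambda>h. apply_ell2 \<xi> h * cnj (apply_ell2 \<eta> h)"]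
    by (simp add: cocycle_unit cinner.rep_eq)
  finally show ?thesis .
qed

lemma L_inv_adjoint: "is_adjoint (L_inv g) (L g)"
  unfolding is_adjoint_def
proof (intro allI)
  fix \<xi> \<eta>
  have "L g (L_inv g \<eta>) = \<eta>"
    using arg_cong[OF L_L_inv[of g], of "\<lambda>T. blinfun_apply T \<eta>"] by simp
  then show "cinner (L g \<xi>) \<eta> = cinner \<xi> (L_inv g \<eta>)"
    using L_cinner[of g \<xi> "L_inv g \<eta>"] by simp
qed

lemma L_norm: "norm (L g \<xi>) = norm \<xi>"
  by (simp add: norm_eq_sqrt_inner inner_ell2_def L_cinner)

lemma L_inv_norm: "norm (L_inv g \<xi>) = norm \<xi>"
  using L_norm[of g "L_inv g \<xi>"] arg_cong[OF L_L_inv[of g], of "\<lambda>T. blinfun_apply T \<xi>"] by simp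

definition monomials :: "'g op set"
  where "monomials = {op_cscale c (L g) | c g. True}"

lemma monomials_scale: "T \<in> monomials \<Longrightarrow> op_cscale c T \<in> monomials"
  unfolding monomials_def using op_cscale_op_cscale by fastforce

lemma monomials_compose: "S \<in> monomials \<Longrightarrow> T \<in> monomials \<Longrightarrow> S o\<^sub>L T \<in> monomials"
  unfolding monomials_def
  by (auto simp: op_cscale_compose_left op_cscale_compose_right[OF L_complex_linear] L_mult
      op_cscale_op_cscale) blast

lemma L_monomial: "L g \<in> monomials"
  unfolding monomials_def by (rule CollectI) (metis op_cscale_1)

lemma monomials_adjoint:
  assumes "T \<in> monomials"
  shows "\<exists>S\<in>monomials. is_adjoint S T"
proof -
  obtain c g where T: "T = op_cscale c (L g)" using assms by (auto simp: monomials_def)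
  have "op_cscale (cnj c) (L_inv g) \<in> monomials"
    unfolding L_inv_def by (intro monomials_scale L_monomial)
  then show ?thesis using is_adjoint_op_cscale[OF L_inv_adjoint] T by blast
qed

text \<open>
  Together with the next two lemmas: the real span of the monomials is already closed under all
  operations of a complex algebra with adjoints, since the monomials absorb complex scalars.
\<close>

lemma span_monomials_adjoint: "T \<in> span monomials \<Longrightarrow> \<exists>S\<in>span monomials. is_adjoint S T"
proof (induction T rule: span_induct_alt)
  case base
  then show ?case by (intro bexI[of _ 0]) (auto simp: span_zero is_adjoint_def cinner_zero)
next
  case (step r T T')
  then show ?case
    using monomials_adjoint[of T] by (meson is_adjoint_add is_adjoint_scaleR span_add span_base span_scale)
qed

lemma span_monomials_scale: "T \<in> span monomials \<Longrightarrow> op_cscale c T \<in> span monomials"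
proof (induction T rule: span_induct_alt)
  case base
  then show ?case by (simp add: span_zero)
next
  case (step r T T')
  then show ?case
    by (simp add: op_cscale_add op_cscale_scaleR span_add span_scale span_base monomials_scale)
qed

lemma span_monomials_compose:
  assumes "S \<in> span monomials" "T \<in> span monomials"
  shows "S o\<^sub>L T \<in> span monomials"
proof -
  have *: "S o\<^sub>L T \<in> span monomials" if "S \<in> monomials" for S
    using assms(2)
  proof (induction T rule: span_induct_alt)
    case base
    then show ?case
      by (simp add: bounded_bilinear.zero_right[OF bounded_bilinear_blinfun_compose] span_zero)
  next
    case (step r T T')
    then show ?case
      by (simp add: compose_add_right compose_scaleR_right span_add span_scale span_base
          monomials_compose that)
  qed
  show ?thesis
    using assms(1)
  proof (induction S rule: span_induct_alt)
    case base
    then show ?case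
      by (simp add: bounded_bilinear.zero_left[OF bounded_bilinear_blinfun_compose] span_zero)
  next
    case (step r T T')
    then show ?case by (simp add: compose_add_left compose_scaleR_left span_add span_scale *)
  qed
qed

lemma span_monomials_complex_linear: "T \<in> span monomials \<Longrightarrow> complex_linear T"
proof (induction T rule: span_induct_alt)
  case base
  then show ?case by (auto simp: complex_linear_def zero_ell2.rep_eq cscale.rep_eq intro!: ell2_eqI)
next
  case (step r T T')
  then obtain c g where T: "T = op_cscale c (L g)" by (auto simp: monomials_def)
  with step L_complex_linear[of g] show ?case
    by (simp add: complex_linear_def blinfun.add_left blinfun.scaleR_left cscale_add op_cscale_apply
        scaleR_eq_cscale cscale_cscale mult_ac)
qed

text \<open>
  All operations are continuous, so they pass to limits.  For adjoints, the adjoints of a convergent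
  sequence are again a Cauchy sequence because taking adjoints preserves distances.
\<close>

lemma cstar_subalgebra_closure_span: "cstar_subalgebra (closure (span monomials))"
proof -
  let ?C = "closure (span monomials)"
  have seq: "\<exists>f. (\<forall>n. f n \<in> span monomials) \<and> f \<longlonglongrightarrow> T" if "T \<in> ?C" for T
    using that unfolding closure_sequential by blast
  have lim: "T \<in> ?C" if "\<And>n. f n \<in> span monomials" "f \<longlonglongrightarrow> T" for f T
    using that unfolding closure_sequential by blast
  have "complex_linear T" if "T \<in> ?C" for T
    using seq[OF that] complex_linear_limit span_monomials_complex_linear by blast
  moreover have "S + T \<in> ?C" if ST: "S \<in> ?C" "T \<in> ?C" for S T
  proof -
    obtain f g where fg: "\<And>n. f n \<in> span monomials" "\<And>n. g n \<in> span monomials"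
        "f \<longlonglongrightarrow> S" "g \<longlonglongrightarrow> T"
      using seq[OF ST(1)] seq[OF ST(2)] by blast
    show ?thesis
      by (rule lim[of "\<lambda>n. f n + g n"]) (intro span_add fg tendsto_add)+
  qed
  moreover have "op_cscale c T \<in> ?C" if T: "T \<in> ?C" for c T
  proof -
    obtain f where f: "\<And>n. f n \<in> span monomials" "f \<longlonglongrightarrow> T" using seq[OF T] by blast
    show ?thesis
      by (rule lim[of "\<lambda>n. op_cscale c (f n)"])
        (intro span_monomials_scale f bounded_linear.tendsto[OF bounded_linear_op_cscale])+
  qed
  moreover have "S o\<^sub>L T \<in> ?C" if ST: "S \<in> ?C" "T \<in> ?C" for S T
  proof -
    obtain f g where fg: "\<And>n. f n \<in> span monomials" "\<And>n. g n \<in> span monomials"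
        "f \<longlonglongrightarrow> S" "g \<longlonglongrightarrow> T"
      using seq[OF ST(1)] seq[OF ST(2)] by blast
    show ?thesis
      by (rule lim[of "\<lambda>n. f n o\<^sub>L g n"]) (intro span_monomials_compose fg tendsto_compose)+
  qed
  moreover have "\<exists>S\<in>?C. is_adjoint S T" if T: "T \<in> ?C" for T
  proof -
    obtain f where f: "\<And>n. f n \<in> span monomials" "f \<longlonglongrightarrow> T" using seq[OF T] by blast
    have "\<forall>n. \<exists>S\<in>span monomials. is_adjoint S (f n)" using f(1) span_monomials_adjoint by blast
    then obtain g where g: "\<And>n. g n \<in> span monomials" "\<And>n. is_adjoint (g n) (f n)" by metis
    have "dist (g m) (g n) = dist (f m) (f n)" for m n
      unfolding dist_norm by (intro is_adjoint_norm is_adjoint_diff g)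
    then have "Cauchy g"
      using LIMSEQ_imp_Cauchy[OF f(2)] unfolding Cauchy_def by simp
    then obtain S where "g \<longlonglongrightarrow> S" using Cauchy_convergent convergent_def by blast
    then show ?thesis using lim[of g S] g is_adjoint_limit f(2) by blast
  qed
  moreover have "0 \<in> ?C" using closure_subset span_zero by blast
  ultimately show ?thesis
    unfolding cstar_subalgebra_def op_csubspace_def complex_linear_def
    by (intro conjI ballI allI closed_closure) simp_all
qed

lemma reduced_eq: "A = closure (span monomials)"
proof (rule subset_antisym)
  have "range L \<subseteq> closure (span monomials)"
    using L_monomial span_base closure_subset by blast
  then show "A \<subseteq> closure (span monomials)"
    unfolding reduced_twisted_cstar_def cstar_generated_def
    using cstar_subalgebra_closure_span by blast
  have "closure (span monomials) \<subseteq> B" if B: "cstar_subalgebra B" "range L \<subseteq> B" for B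
  proof -
    have scale: "op_cscale c T \<in> B" if "T \<in> B" for c T
      using B(1) that by (auto simp: cstar_subalgebra_def op_csubspace_def)
    have "subspace B"
      using B(1) scale[of _ "of_real _"]
      by (auto simp: subspace_def cstar_subalgebra_def op_csubspace_def op_cscale_of_real)
    moreover have "monomials \<subseteq> B" using B(2) scale by (auto simp: monomials_def)
    ultimately show ?thesis
      using B(1) by (intro closure_minimal span_minimal) (auto simp: cstar_subalgebra_def)
  qed
  then show "closure (span monomials) \<subseteq> A"
    unfolding reduced_twisted_cstar_def cstar_generated_def by blast
qed

lemma cstar_subalgebra_A: "cstar_subalgebra A"
  using cstar_subalgebra_closure_span by (simp add: reduced_eq)

lemma L_in_A: "L g \<in> A"
  unfolding reduced_eq by (intro subsetD[OF closure_subset] span_base L_monomial)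

lemma A_add: "S \<in> A \<Longrightarrow> T \<in> A \<Longrightarrow> S + T \<in> A"
  and A_scale: "T \<in> A \<Longrightarrow> op_cscale c T \<in> A"
  and A_compose: "S \<in> A \<Longrightarrow> T \<in> A \<Longrightarrow> S o\<^sub>L T \<in> A"
  and A_complex_linear: "T \<in> A \<Longrightarrow> complex_linear T"
  using cstar_subalgebra_A unfolding cstar_subalgebra_def op_csubspace_def complex_linear_def
  by blast+

lemma A_scaleR: "T \<in> A \<Longrightarrow> r *\<^sub>R T \<in> A"
  using A_scale[of T "of_real r"] by (simp add: op_cscale_of_real)

lemma A_diff: "S \<in> A \<Longrightarrow> T \<in> A \<Longrightarrow> S - T \<in> A"
  using A_add[of S "(-1) *\<^sub>R T"] A_scaleR[of T "-1"] by simp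

lemma A_id: "id_blinfun \<in> A"
  using L_in_A[of 0] by (simp add: L_zero)

lemma L_inv_in_A: "L_inv g \<in> A"
  unfolding L_inv_def by (intro A_scale L_in_A)

text \<open>
  A property of the elements of the algebra that is additive and passes to norm limits needs to be
  checked only on the multiples of the generators.
\<close>

lemma reduced_induct [consumes 1, case_names monomial add limit]:
  assumes T: "T \<in> A"
    and monomial: "\<And>c g. P (op_cscale c (L g))"
    and add: "\<And>S T. S \<in> A \<Longrightarrow> T \<in> A \<Longrightarrow> P S \<Longrightarrow> P T \<Longrightarrow> P (S + T)"
    and limit: "\<And>f T. (\<And>n. f n \<in> A) \<Longrightarrow> (\<And>n. P (f n)) \<Longrightarrow> T \<in> A \<Longrightarrow> f \<longlonglongrightarrow> T \<Longrightarrow> P T"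
  shows "P T"
proof -
  have mono: "P S" if "S \<in> monomials" for S
    using that monomial by (auto simp: monomials_def)
  have span: "S \<in> A \<and> P S" if "S \<in> span monomials" for S
    using that
  proof (induction S rule: span_induct_alt)
    case base
    have "op_cscale 0 (L 0) = 0"
      using op_cscale_of_real[of 0 "L 0"] by simp
    then show ?case using monomial[of 0 0] A_scale[OF L_in_A, of 0 0] by simp
  next
    case (step r S S')
    have "r *\<^sub>R S \<in> monomials"
      using monomials_scale[OF step(1), of "of_real r"] by (simp add: op_cscale_of_real)
    then have "r *\<^sub>R S \<in> A" "P (r *\<^sub>R S)"
      using mono by (auto simp: monomials_def intro!: A_scale L_in_A)
    then show ?case using step add A_add by blast
  qed
  obtain f where "\<And>n. f n \<in> span monomials" "f \<longlonglongrightarrow> T"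
    using T unfolding reduced_eq closure_sequential by blast
  then show ?thesis using limit[of f T] span T by blast
qed

section \<open>Traces as limits of vector states\<close>

text \<open>
  The functionals \<open>T \<mapsto> \<langle>T \<xi>\<^sub>n, \<xi>\<^sub>n\<rangle>\<close> are uniformly bounded, so convergence on the generators gives
  convergence on the whole algebra.  The limit is positive as a limit of positive functionals, and its
  trace property need only be tested on pairs of generators, where it is the condition on \<open>\<omega>\<close>.
\<close>

lemma tracial_state_limit:
  fixes \<xi> :: "nat \<Rightarrow> 'g ell2" and \<omega> :: "'g \<Rightarrow> complex"
  defines "\<tau> \<equiv> \<lambda>T. lim (\<lambda>n. cinner (blinfun_apply T (\<xi> n)) (\<xi> n))"
  assumes unit: "\<And>n. norm (\<xi> n) = 1"
    and coefficient: "\<And>g. (\<lambda>n. cinner (L g (\<xi> n)) (\<xi> n)) \<longlonglongrightarrow> \<omega> g"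
    and tracial: "\<And>g h. \<sigma> g h * \<omega> (g + h) = \<sigma> h g * \<omega> (h + g)"
  shows "tracial_state A \<tau>" and "\<tau> (L g) = \<omega> g"
proof -
  let ?c = "\<lambda>T n. cinner (blinfun_apply T (\<xi> n)) (\<xi> n)"
  have bound: "cmod (?c T n) \<le> 2 * norm T" for T n
    using cmod_cinner_le[of "T (\<xi> n)" "\<xi> n"] norm_blinfun[of T "\<xi> n"] by (simp add: unit)
  have c_diff: "?c (S - T) n = ?c S n - ?c T n" for S T n
    by (simp add: blinfun.diff_left bounded_bilinear.diff_left[OF bounded_bilinear_cinner])
  have conv: "convergent (?c T)" if "T \<in> A" for T
    using that
  proof (induction T rule: reduced_induct)
    case (monomial c g)
    have "(\<lambda>n. c * ?c (L g) n) \<longlonglongrightarrow> c * \<omega> g" by (intro tendsto_intros coefficient)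
    then show ?case by (auto simp: convergent_def op_cscale_apply cinner_cscale_left)
  next
    case (add S T)
    then show ?case by (simp add: blinfun.add_left cinner_add_left convergent_add)
  next
    case (limit f T)
    have "Cauchy (?c T)"
    proof (rule metric_CauchyI)
      fix e :: real assume "e > 0"
      then obtain k where k: "norm (f k - T) < e / 8"
        using LIMSEQ_D[OF limit.hyps(3), of "e / 8"] by auto
      obtain M where M: "\<And>m n. m \<ge> M \<Longrightarrow> n \<ge> M \<Longrightarrow> dist (?c (f k) m) (?c (f k) n) < e / 4"
        using metric_CauchyD[OF convergent_Cauchy[OF limit.IH[of k]], of "e / 4"] \<open>e > 0\<close> by auto
      have near: "dist (?c (f k) n) (?c T n) < e / 4" for n
        using bound[of "f k - T" n] k by (simp add: c_diff dist_norm)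
      have "dist (?c T m) (?c T n) < e" if "m \<ge> M" "n \<ge> M" for m n
        using M[OF that] near[of m] near[of n]
          dist_triangle[of "?c T m" "?c T n" "?c (f k) m"] dist_triangle[of "?c (f k) m" "?c T n" "?c (f k) n"]
        \<open>e > 0\<close> by (simp add: dist_commute)
      then show "\<exists>M. \<forall>m\<ge>M. \<forall>n\<ge>M. dist (?c T m) (?c T n) < e" by blast
    qed
    then show ?case by (rule Cauchy_convergent)
  qed
  have lim: "?c T \<longlonglongrightarrow> \<tau> T" if "T \<in> A" for T
    using conv[OF that] by (simp add: \<tau>_def convergent_LIMSEQ_iff)
  have \<tau>I: "\<tau> T = x" if "?c T \<longlonglongrightarrow> x" for T x
    unfolding \<tau>_def using that by (rule limI)
  have \<tau>_L: "\<tau> (L g) = \<omega> g" for g by (intro \<tau>I coefficient)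
  have \<tau>_add: "\<tau> (S + T) = \<tau> S + \<tau> T" if "S \<in> A" "T \<in> A" for S T
    using tendsto_add[OF lim[OF that(1)] lim[OF that(2)]]
    by (intro \<tau>I) (simp add: blinfun.add_left cinner_add_left)
  have \<tau>_scale: "\<tau> (op_cscale c T) = c * \<tau> T" if "T \<in> A" for c T
    using tendsto_mult_left[OF lim[OF that], of c]
    by (intro \<tau>I) (simp add: op_cscale_apply cinner_cscale_left)
  have \<tau>_bound: "cmod (\<tau> T) \<le> 2 * norm T" if "T \<in> A" for T
    by (rule LIMSEQ_le_const2[OF tendsto_norm[OF lim[OF that]]]) (use bound in blast)
  have \<tau>_tendsto: "(\<lambda>n. \<tau> (f n)) \<longlonglongrightarrow> \<tau> T" if f: "\<And>n. f n \<in> A" "T \<in> A" "f \<longlonglongrightarrow> T" for f T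
  proof -
    have "\<tau> (f n) - \<tau> T = \<tau> (f n - T)" for n
      using \<tau>_add[OF A_diff[OF f(1)[of n] f(2)] f(2)] by simp
    then have "cmod (\<tau> (f n) - \<tau> T) \<le> 2 * norm (f n - T)" for n
      using \<tau>_bound[OF A_diff[OF f(1)[of n] f(2)]] by simp
    moreover have "(\<lambda>n. 2 * norm (f n - T)) \<longlonglongrightarrow> 0"
      using f(3) by (simp add: LIM_zero tendsto_mult_right_zero tendsto_norm_zero)
    ultimately have "(\<lambda>n. \<tau> (f n) - \<tau> T) \<longlonglongrightarrow> 0"
      by (rule Lim_null_comparison[OF always_eventually, rule_format])
    then show ?thesis by (rule LIM_zero_cancel)
  qed
  have trace_L: "\<tau> (L g o\<^sub>L L h) = \<tau> (L h o\<^sub>L L g)" for g h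
    by (simp add: L_mult \<tau>_scale L_in_A \<tau>_L tracial)
  have trace_L_right: "\<tau> (S o\<^sub>L L h) = \<tau> (L h o\<^sub>L S)" if "S \<in> A" for S h
    using that
  proof (induction S rule: reduced_induct)
    case (monomial c g)
    then show ?case
      by (simp add: op_cscale_compose_left op_cscale_compose_right[OF L_complex_linear] \<tau>_scale
          A_compose L_in_A trace_L)
  next
    case (add S T)
    then show ?case by (simp add: compose_add_left compose_add_right \<tau>_add A_compose L_in_A)
  next
    case (limit f T)
    have "(\<lambda>n. \<tau> (f n o\<^sub>L L h)) \<longlonglongrightarrow> \<tau> (T o\<^sub>L L h)"
      by (intro \<tau>_tendsto A_compose limit.hyps L_in_A tendsto_compose tendsto_const)
    moreover have "(\<lambda>n. \<tau> (L h o\<^sub>L f n)) \<longlonglongrightarrow> \<tau> (L h o\<^sub>L T)"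
      by (intro \<tau>_tendsto A_compose limit.hyps L_in_A tendsto_compose tendsto_const)
    ultimately show ?case using limit.IH LIMSEQ_unique by fastforce
  qed
  have trace: "\<tau> (S o\<^sub>L T) = \<tau> (T o\<^sub>L S)" if S: "S \<in> A" and T: "T \<in> A" for S T
    using T
  proof (induction T rule: reduced_induct)
    case (monomial c h)
    then show ?case
      by (simp add: op_cscale_compose_left op_cscale_compose_right[OF A_complex_linear[OF S]] \<tau>_scale
          A_compose L_in_A S trace_L_right)
  next
    case (add T T')
    then show ?case by (simp add: compose_add_left compose_add_right \<tau>_add A_compose S)
  next
    case (limit f T)
    have "(\<lambda>n. \<tau> (f n o\<^sub>L S)) \<longlonglongrightarrow> \<tau> (T o\<^sub>L S)"
      by (intro \<tau>_tendsto A_compose limit.hyps S tendsto_compose tendsto_const)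
    moreover have "(\<lambda>n. \<tau> (S o\<^sub>L f n)) \<longlonglongrightarrow> \<tau> (S o\<^sub>L T)"
      by (intro \<tau>_tendsto A_compose limit.hyps S tendsto_compose tendsto_const)
    ultimately show ?case using limit.IH LIMSEQ_unique by fastforce
  qed
  have pos: "\<tau> (S o\<^sub>L T) \<in> \<real>\<^sub>\<ge>\<^sub>0" if "S \<in> A" "T \<in> A" "is_adjoint S T" for S T
  proof (rule Lim_in_closed_set[OF closed_nonneg_Reals_complex _ _ lim[OF A_compose[OF that(1,2)]]])
    have "?c (S o\<^sub>L T) n = of_real ((norm (T (\<xi> n)))\<^sup>2)" for n
      using that(3) unfolding is_adjoint_commute[of S T]
      by (simp only: is_adjoint_def blinfun_compose.rep_eq o_apply cinner_self_norm)
    then show "\<forall>\<^sub>F n in sequentially. ?c (S o\<^sub>L T) n \<in> \<real>\<^sub>\<ge>\<^sub>0"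
      by (simp only: nonneg_Reals_of_real_iff) simp
  qed simp
  have "\<tau> id_blinfun = 1"
    by (rule \<tau>I) (simp add: cinner_self_norm unit)
  then show "tracial_state A \<tau>"
    unfolding tracial_state_def using \<tau>_add \<tau>_scale pos trace by blast
  show "\<tau> (L g) = \<omega> g" by (rule \<tau>_L)
qed

text \<open>
  On a finite subgroup \<open>F\<close>, \<open>\<phi>\<close> is a character of the twisted group algebra, and the normalized
  vector of its conjugate values is an eigenvector of every \<open>L g\<close> with \<open>g \<in> F\<close> for the eigenvalue
  \<open>\<phi> g\<close>.  For \<open>g\<close> outside \<open>F\<close>, \<open>L g\<close> moves the support to a disjoint coset.
\<close>

lemma character_vector:
  fixes \<phi> :: "'g \<Rightarrow> complex"
  assumes F: "finite F" "0 \<in> F" "\<And>a b. a \<in> F \<Longrightarrow> b \<in> F \<Longrightarrow> a + b \<in> F" "\<And>a. a \<in> F \<Longrightarrow> - a \<in> F"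
    and unit: "\<And>a. a \<in> F \<Longrightarrow> cmod (\<phi> a) = 1"
    and mult: "\<And>a b. a \<in> F \<Longrightarrow> b \<in> F \<Longrightarrow> \<sigma> a b * \<phi> (a + b) = \<phi> a * \<phi> b"
  shows "\<exists>\<xi>. norm \<xi> = 1 \<and> (\<forall>g. cinner (L g \<xi>) \<xi> = (if g \<in> F then \<phi> g else 0))"
proof -
  define f where "f h = (if h \<in> F then cnj (\<phi> h) / sqrt (card F) else 0)" for h
  have card: "card F > 0" using F by (auto simp: card_gt_0_iff)
  have "(\<lambda>h. (cmod (f h))\<^sup>2) summable_on UNIV \<longleftrightarrow> (\<lambda>h. (cmod (f h))\<^sup>2) summable_on F"
    by (rule summable_on_cong_neutral) (auto simp: f_def)
  then have app: "apply_ell2 (Abs_ell2 f) = f" using F(1) by (simp add: Abs_ell2_inverse)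
  let ?\<xi> = "Abs_ell2 f"
  have "(\<Sum>\<^sub>\<infinity>h. (cmod (f h))\<^sup>2) = (\<Sum>\<^sub>\<infinity>h\<in>F. 1 / card F)"
    by (rule infsum_cong_neutral) (use unit in \<open>auto simp: f_def norm_divide power_divide\<close>)
  then have norm: "norm ?\<xi> = 1"
    unfolding norm_ell2 app using F(1,2) card by auto
  have "cinner (L g ?\<xi>) ?\<xi> = (if g \<in> F then \<phi> g else 0)" for g
  proof (cases "g \<in> F")
    case True
    have "L g ?\<xi> = cscale (\<phi> g) ?\<xi>"
    proof (rule ell2_eqI)
      fix h
      show "apply_ell2 (L g ?\<xi>) h = apply_ell2 (cscale (\<phi> g) ?\<xi>) h"
      proof (cases "h \<in> F")
        case h: True
        define a where "a = - g + h"
        have a: "a \<in> F" "h = g + a" using F h True by (auto simp: a_def simp flip: add.assoc)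
        have *: "\<phi> h * cnj (\<phi> h) = 1" "\<phi> a * cnj (\<phi> a) = 1"
          using unit[OF h] unit[OF a(1)] by (simp_all add: complex_norm_square[symmetric])
        \<comment> \<open>Multiplicativity \<open>\<sigma> g a * \<phi> (g + a) = \<phi> g * \<phi> a\<close>, multiplied by the conjugates of
          \<open>\<phi> a\<close> and \<open>\<phi> (g + a)\<close>.\<close>
        have "\<sigma> g a * cnj (\<phi> a) = (\<sigma> g a * \<phi> h) * cnj (\<phi> a) * cnj (\<phi> h)"
          using *(1) by (simp add: mult_ac)
        also have "\<dots> = \<phi> g * cnj (\<phi> h) * (\<phi> a * cnj (\<phi> a))"
          using mult[OF True a(1)] a(2) by (simp add: mult_ac)
        finally have "\<sigma> g a * cnj (\<phi> a) = \<phi> g * cnj (\<phi> h)" using * by simp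
        then show ?thesis
          using h a(1) by (simp add: L_apply app cscale.rep_eq f_def a_def[symmetric])
      next
        case False
        then have "- g + h \<notin> F" using F(3)[OF True, of "- g + h"] by (auto simp flip: add.assoc)
        with False show ?thesis by (simp add: L_apply app cscale.rep_eq f_def)
      qed
    qed
    then show ?thesis
      using True by (simp add: cinner_cscale_left cinner_self_norm norm)
  next
    case False
    have "apply_ell2 (L g ?\<xi>) h * cnj (apply_ell2 ?\<xi> h) = 0" for h
    proof (rule ccontr)
      assume "apply_ell2 (L g ?\<xi>) h * cnj (apply_ell2 ?\<xi> h) \<noteq> 0"
      then have "- g + h \<in> F" "h \<in> F" by (auto simp: L_apply app f_def split: if_splits)
      then have "h + - (- g + h) \<in> F" using F by blast
      then show False using False by (simp add: minus_add flip: add.assoc)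
    qed
    then show ?thesis using False unfolding cinner.rep_eq by (simp only: infsum_0 if_False)
  qed
  with norm show ?thesis by blast
qed

text \<open>
  The coefficients of the eigenvectors for \<open>F n\<close> are eventually constant at each group element, so they
  converge to \<open>\<phi>\<close> on the union of the subgroups and to \<open>0\<close> elsewhere.
\<close>

lemma tracial_state_of_character:
  fixes F :: "nat \<Rightarrow> 'g set" and \<phi> :: "'g \<Rightarrow> complex"
  defines "\<omega> \<equiv> \<lambda>g. if g \<in> (\<Union>n. F n) then \<phi> g else 0"
  assumes F: "\<And>n. finite (F n)" "\<And>n. 0 \<in> F n" "\<And>n a b. a \<in> F n \<Longrightarrow> b \<in> F n \<Longrightarrow> a + b \<in> F n"
      "\<And>n a. a \<in> F n \<Longrightarrow> - a \<in> F n"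
    and mono: "incseq F"
    and unit: "\<And>n a. a \<in> F n \<Longrightarrow> cmod (\<phi> a) = 1"
    and mult: "\<And>n a b. a \<in> F n \<Longrightarrow> b \<in> F n \<Longrightarrow> \<sigma> a b * \<phi> (a + b) = \<phi> a * \<phi> b"
    and tracial: "\<And>g h. \<sigma> g h * \<omega> (g + h) = \<sigma> h g * \<omega> (h + g)"
  shows "\<exists>\<tau>. tracial_state A \<tau> \<and> (\<forall>g. \<tau> (L g) = \<omega> g)"
proof -
  have "\<forall>n. \<exists>\<xi>. norm \<xi> = 1 \<and> (\<forall>g. cinner (L g \<xi>) \<xi> = (if g \<in> F n then \<phi> g else 0))"
    by (intro allI character_vector F unit mult)
  then obtain \<xi> where \<xi>: "\<And>n. norm (\<xi> n) = 1"
      "\<And>n g. cinner (L g (\<xi> n)) (\<xi> n) = (if g \<in> F n then \<phi> g else 0)"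
    by metis
  have "(\<lambda>n. cinner (L g (\<xi> n)) (\<xi> n)) \<longlonglongrightarrow> \<omega> g" for g
  proof (cases "g \<in> (\<Union>n. F n)")
    case True
    then obtain N where "g \<in> F N" by blast
    then have "g \<in> F n" if "n \<ge> N" for n using mono that by (auto simp: incseq_def)
    then have "\<forall>\<^sub>F n in sequentially. cinner (L g (\<xi> n)) (\<xi> n) = \<omega> g"
      using True unfolding eventually_sequentially \<omega>_def by (auto simp: \<xi> intro!: exI[of _ N])
    then show ?thesis by (rule tendsto_eventually)
  next
    case False
    then show ?thesis by (auto simp: \<xi> \<omega>_def)
  qed
  from tracial_state_limit[OF \<xi>(1) this tracial] show ?thesis by blast
qed

definition canonical_trace :: "'g op \<Rightarrow> complex"
  where "canonical_trace T = cinner (T (delta 0)) (delta 0)"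

lemma canonical_trace_L: "canonical_trace (L g) = (if g = 0 then 1 else 0)"
  by (auto simp: canonical_trace_def L_delta cinner_delta apply_delta)

lemma tracial_state_canonical_trace: "tracial_state A canonical_trace"
proof -
  have eq: "canonical_trace = (\<lambda>T. lim (\<lambda>n::nat. cinner (blinfun_apply T (delta 0)) (delta 0)))"
    by (auto simp: canonical_trace_def)
  show ?thesis
    unfolding eq
  proof (rule tracial_state_limit)
    show "(\<lambda>n. cinner (L g (delta 0)) (delta 0)) \<longlonglongrightarrow> (if g = 0 then 1 else 0)" for g
      using canonical_trace_L[of g] by (simp add: canonical_trace_def)
    show "\<sigma> g h * (if g + h = 0 then 1 else 0) = \<sigma> h g * (if h + g = 0 then 1 else 0)" for g h
    proof (cases "g + h = 0")
      case True
      then have "h = - g" by (simp add: add_eq_0_iff)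
      then show ?thesis by (simp add: cocycle_inverse)
    next
      case False
      then have "h + g \<noteq> 0" by (auto simp: add_eq_0_iff)
      with False show ?thesis by simp
    qed
  qed (simp add: norm_delta)
qed

text \<open>
  By the trace property, \<open>\<parallel>T L\<^sub>g \<delta>\<^sub>0\<parallel>\<close> does not depend on \<open>g\<close>; so if it vanishes for \<open>g = 0\<close>, then
  \<open>T\<close> kills every basis vector.  Passing to the adjoint, whose matrix is then zero as well, shows
  \<open>T = 0\<close> without a density argument.
\<close>

lemma canonical_trace_faithful:
  assumes T: "T \<in> A" "T \<noteq> 0" and S: "S \<in> A" "is_adjoint S T"
  shows "canonical_trace (S o\<^sub>L T) \<noteq> 0"
proof
  assume zero: "canonical_trace (S o\<^sub>L T) = 0"
  have adj: "cinner (S \<xi>) \<eta> = cinner \<xi> (T \<eta>)" for \<xi> \<eta>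
    using S(2) unfolding is_adjoint_commute[of S] by (simp add: is_adjoint_def)
  have T_delta: "T (delta g) = 0" for g
  proof -
    have "canonical_trace ((L_inv g o\<^sub>L (S o\<^sub>L T)) o\<^sub>L L g)
        = canonical_trace (L g o\<^sub>L (L_inv g o\<^sub>L (S o\<^sub>L T)))"
      using tracial_state_canonical_trace
        A_compose[OF L_inv_in_A A_compose[OF S(1) T(1)], of g] L_in_A[of g]
      unfolding tracial_state_def by blast
    also have "\<dots> = 0"
      using zero by (simp add: L_L_inv flip: compose_assoc)
    finally have "cinner (L_inv g (S (T (L g (delta 0))))) (delta 0) = 0"
      by (simp add: canonical_trace_def)
    then have "cinner (T (delta g)) (T (delta g)) = 0"
      using L_inv_adjoint[of g] unfolding is_adjoint_commute[of "L_inv g"]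
      by (simp add: is_adjoint_def L_delta adj)
    then show ?thesis by (simp add: cinner_self_norm)
  qed
  have "S (delta h) = 0" for h
  proof (rule ell2_eqI)
    fix g
    show "apply_ell2 (S (delta h)) g = apply_ell2 0 g"
      using adj[of "delta h" "delta g"] by (simp add: T_delta cinner_zero cinner_delta zero_ell2.rep_eq)
  qed
  then have "T \<xi> = 0" for \<xi>
    using S(2) cinner_delta[of "T \<xi>"] by (intro ell2_eqI) (simp add: is_adjoint_def cinner_zero zero_ell2.rep_eq)
  then have "T = 0" by (intro blinfun_eqI) simp
  with T(2) show False ..
qed

section \<open>Averages of conjugates\<close>

definition conj_by :: "'g \<Rightarrow> 'g op \<Rightarrow> 'g op"
  where "conj_by g T = L g o\<^sub>L T o\<^sub>L L_inv g"

lemma L_inv_complex_linear: "complex_linear (L_inv g)"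
  by (rule A_complex_linear[OF L_inv_in_A])

lemma conj_by_add: "conj_by g (S + T) = conj_by g S + conj_by g T"
  by (simp add: conj_by_def compose_add_left compose_add_right)

lemma conj_by_scaleR: "conj_by g (r *\<^sub>R T) = r *\<^sub>R conj_by g T"
  by (simp add: conj_by_def compose_scaleR_left compose_scaleR_right)

lemma conj_by_op_cscale: "conj_by g (op_cscale c T) = op_cscale c (conj_by g T)"
  by (simp add: conj_by_def op_cscale_compose_left op_cscale_compose_right[OF L_complex_linear])

lemma conj_by_id: "conj_by g id_blinfun = id_blinfun"
  by (simp add: conj_by_def L_L_inv)

lemma norm_conj_by: "norm (conj_by g T) \<le> norm T"
proof (rule norm_blinfun_bound)
  fix \<xi>
  show "norm (conj_by g T \<xi>) \<le> norm T * norm \<xi>"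
    using norm_blinfun[of T "L_inv g \<xi>"] by (simp add: conj_by_def L_norm L_inv_norm)
qed simp

text \<open>
  The phase of the product \<open>L g L h\<close> cancels against that of its adjoint.  Conjugations are thus an honest
  action of the group, and those by commuting group elements commute.
\<close>

lemma conj_by_conj_by:
  assumes "complex_linear T"
  shows "conj_by g (conj_by h T) = conj_by (g + h) T"
proof -
  have "L_inv h o\<^sub>L L_inv g = op_cscale (cnj (\<sigma> g h)) (L_inv (g + h))"
    by (rule is_adjoint_unique[OF is_adjoint_compose[OF L_inv_adjoint L_inv_adjoint]])
      (simp add: L_mult is_adjoint_op_cscale L_inv_adjoint)
  moreover have "conj_by g (conj_by h T) = (L g o\<^sub>L L h) o\<^sub>L (T o\<^sub>L (L_inv h o\<^sub>L L_inv g))"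
    by (simp add: conj_by_def compose_assoc)
  ultimately show ?thesis
    by (simp add: L_mult conj_by_def compose_assoc op_cscale_compose_left op_cscale_compose_right
        op_cscale_op_cscale cocycle_unit assms L_complex_linear)
qed

lemma L_inv_compose: "\<exists>c. cmod c = 1 \<and> L_inv g o\<^sub>L L h = op_cscale c (L (- g + h))"
  by (intro exI[of _ "cnj (\<sigma> g (- g)) * \<sigma> (- g) h"])
    (simp add: L_inv_def op_cscale_compose_left L_mult op_cscale_op_cscale cocycle_unit norm_mult)

lemma conj_by_L: "\<exists>c. cmod c = 1 \<and> conj_by g (L h) = op_cscale c (L (g + h - g))"
  by (intro exI[of _ "\<sigma> g h * (cnj (\<sigma> g (- g)) * \<sigma> (g + h) (- g))"])
    (simp add: conj_by_def L_inv_def op_cscale_compose_left op_cscale_compose_right[OF L_complex_linear]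
      op_cscale_compose_right[OF A_complex_linear[OF A_scale[OF L_in_A]]]
      L_mult op_cscale_op_cscale cocycle_unit norm_mult)

lemma conj_by_L_commuting:
  assumes "g + h = h + g"
  shows "conj_by g (L h) = op_cscale (\<sigma> g h * cnj (\<sigma> h g)) (L h)"
proof -
  have "op_cscale (cnj (\<sigma> h g)) (L h o\<^sub>L L g) = L (h + g)"
    by (simp add: L_mult op_cscale_op_cscale cocycle_unit)
  then have "L g o\<^sub>L L h = op_cscale (\<sigma> g h) (op_cscale (cnj (\<sigma> h g)) (L h o\<^sub>L L g))"
    unfolding L_mult[of g h] assms by (simp only:)
  then show ?thesis
    by (simp add: conj_by_def op_cscale_compose_left op_cscale_op_cscale compose_assoc L_L_inv)
qed

text \<open>
  The averages over \<open>H\<close>, generated as a convex set of maps that is stable under conjugation by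
  elements of \<open>H\<close>; properties of averages follow by rule induction.
\<close>

inductive averaging :: "'g set \<Rightarrow> ('g op \<Rightarrow> 'g op) \<Rightarrow> bool" for H :: "'g set"
  where
    identity: "averaging H (\<lambda>T. T)"
  | conjugate: "averaging H \<Phi> \<Longrightarrow> t \<in> H \<Longrightarrow> averaging H (\<lambda>T. conj_by t (\<Phi> T))"
  | convex: "averaging H \<Phi> \<Longrightarrow> averaging H \<Psi> \<Longrightarrow> 0 \<le> p \<Longrightarrow> p \<le> 1 \<Longrightarrow>
      averaging H (\<lambda>T. p *\<^sub>R \<Phi> T + (1 - p) *\<^sub>R \<Psi> T)"

lemma averaging_compose:
  "averaging H \<Psi> \<Longrightarrow> averaging H \<Phi> \<Longrightarrow> averaging H (\<lambda>T. \<Psi> (\<Phi> T))"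
  by (induction rule: averaging.induct) (auto intro: averaging.intros)

lemma averaging_add: "averaging H \<Phi> \<Longrightarrow> \<Phi> (S + T) = \<Phi> S + \<Phi> T"
  by (induction rule: averaging.induct) (simp_all add: conj_by_add algebra_simps)

lemma averaging_op_cscale: "averaging H \<Phi> \<Longrightarrow> \<Phi> (op_cscale c T) = op_cscale c (\<Phi> T)"
  by (induction rule: averaging.induct)
    (simp_all add: conj_by_op_cscale op_cscale_add op_cscale_scaleR)

lemma averaging_scaleR: "averaging H \<Phi> \<Longrightarrow> \<Phi> (r *\<^sub>R T) = r *\<^sub>R \<Phi> T"
  using averaging_op_cscale[of H \<Phi> "of_real r" T] by (simp add: op_cscale_of_real)

lemma averaging_diff: "averaging H \<Phi> \<Longrightarrow> \<Phi> (S - T) = \<Phi> S - \<Phi> T"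
  using averaging_add[of H \<Phi> S "(-1) *\<^sub>R T"] averaging_scaleR[of H \<Phi> "-1" T] by simp

lemma averaging_id: "averaging H \<Phi> \<Longrightarrow> \<Phi> id_blinfun = id_blinfun"
  by (induction rule: averaging.induct) (simp_all add: conj_by_id flip: scaleR_add_left)

lemma averaging_norm: "averaging H \<Phi> \<Longrightarrow> norm (\<Phi> T) \<le> norm T"
proof (induction rule: averaging.induct)
  case (conjugate \<Phi> t)
  then show ?case using norm_conj_by order_trans by blast
next
  case (convex \<Phi> \<Psi> p)
  have "norm (p *\<^sub>R \<Phi> T + (1 - p) *\<^sub>R \<Psi> T) \<le> p * norm (\<Phi> T) + (1 - p) * norm (\<Psi> T)"
    using norm_triangle_ineq[of "p *\<^sub>R \<Phi> T" "(1 - p) *\<^sub>R \<Psi> T"] convex.hyps by simp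
  also have "\<dots> \<le> p * norm T + (1 - p) * norm T"
    using convex by (intro add_mono mult_left_mono) auto
  finally show ?case by (simp add: algebra_simps)
qed simp

lemma averaging_in_ideal:
  assumes I: "closed_ideal I A" and "averaging H \<Phi>" "T \<in> I"
  shows "\<Phi> T \<in> I"
  using assms(2)
proof (induction rule: averaging.induct)
  case (conjugate \<Phi> t)
  then show ?case
    using I L_in_A[of t] L_inv_in_A[of t] by (simp add: conj_by_def closed_ideal_def)
next
  case (convex \<Phi> \<Psi> p)
  then show ?case
    using I by (simp add: closed_ideal_def op_csubspace_def flip: op_cscale_of_real)
qed (rule assms(3))

lemma closed_ideal_A: "closed_ideal A A"
  using cstar_subalgebra_A by (simp add: closed_ideal_def cstar_subalgebra_def)

lemma averaging_commute:
  assumes comm: "\<forall>s\<in>H. \<forall>t\<in>H. s + t = t + s"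
    and \<Phi>: "averaging H \<Phi>" and \<Psi>: "averaging H \<Psi>" and T: "T \<in> A"
  shows "\<Phi> (\<Psi> T) = \<Psi> (\<Phi> T)"
proof -
  have in_A: "\<Theta> S \<in> A" if "averaging H \<Theta>" "S \<in> A" for \<Theta> S
    using averaging_in_ideal[OF closed_ideal_A] that .
  have conj: "\<Phi> (conj_by t S) = conj_by t (\<Phi> S)" if t: "t \<in> H" and S: "S \<in> A" for t S
    using \<Phi>
  proof (induction rule: averaging.induct)
    case (conjugate \<Phi> s)
    have "complex_linear (\<Phi> S)" by (rule A_complex_linear[OF in_A[OF conjugate.hyps(1) S]])
    moreover have "s + t = t + s" using comm t conjugate.hyps(2) by blast
    ultimately show ?case using conjugate.IH by (simp add: conj_by_conj_by)
  qed (simp_all add: conj_by_add conj_by_scaleR)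
  show ?thesis
    using \<Psi>
  proof (induction rule: averaging.induct)
    case (conjugate \<Psi> s)
    then show ?case by (simp add: conj in_A[OF conjugate.hyps(1) T])
  qed (simp_all add: averaging_add[OF \<Phi>] averaging_scaleR[OF \<Phi>])
qed

lemma trace_averaging:
  assumes \<tau>: "tracial_state A \<tau>" and "averaging H \<Phi>" and T: "T \<in> A"
  shows "\<tau> (\<Phi> T) = \<tau> T"
  using assms(2)
proof (induction rule: averaging.induct)
  case (conjugate \<Phi> t)
  have \<Phi>: "\<Phi> T \<in> A" by (rule averaging_in_ideal[OF closed_ideal_A conjugate.hyps(1) T])
  have "\<tau> ((L t o\<^sub>L \<Phi> T) o\<^sub>L L_inv t) = \<tau> (L_inv t o\<^sub>L (L t o\<^sub>L \<Phi> T))"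
    using \<tau> A_compose[OF L_in_A \<Phi>] L_inv_in_A unfolding tracial_state_def by blast
  also have "\<dots> = \<tau> (\<Phi> T)" by (simp add: L_inv_L flip: compose_assoc)
  finally show ?case using conjugate.IH by (simp add: conj_by_def)
next
  case (convex \<Phi> \<Psi> p)
  have \<Phi>: "\<Phi> T \<in> A" "\<Psi> T \<in> A"
    by (rule averaging_in_ideal[OF closed_ideal_A _ T], rule convex.hyps)+
  have "\<tau> (p *\<^sub>R \<Phi> T + (1 - p) *\<^sub>R \<Psi> T) = of_real p * \<tau> (\<Phi> T) + of_real (1 - p) * \<tau> (\<Psi> T)"
    using \<tau> \<Phi> unfolding op_cscale_of_real[symmetric] tracial_state_def by (simp add: A_scale)
  then show ?case using convex.IH by (simp add: algebra_simps)
qed simp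

text \<open>
  Stated on vectors, so that no order on operators is needed: conjugation only moves the vector, and
  convex combinations are handled by convexity of \<open>\<parallel>\<cdot>\<parallel>\<^sup>2\<close>.
\<close>

lemma averaging_Kadison_Schwarz:
  assumes "averaging H \<Phi>" "is_adjoint S T"
  shows "(norm (\<Phi> T \<xi>))\<^sup>2 \<le> inner (\<Phi> (S o\<^sub>L T) \<xi>) \<xi>"
  using assms(1)
proof (induction arbitrary: \<xi> rule: averaging.induct)
  case identity
  then show ?case using is_adjoint_norm_sq[OF assms(2)] by simp
next
  case (conjugate \<Phi> t)
  have "inner (conj_by t (\<Phi> (S o\<^sub>L T)) \<xi>) \<xi> = inner (\<Phi> (S o\<^sub>L T) (L_inv t \<xi>)) (L_inv t \<xi>)"
    using L_inv_adjoint[of t] by (simp add: conj_by_def is_adjoint_def inner_ell2_def)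
  with conjugate.IH[of "L_inv t \<xi>"] show ?case by (simp add: conj_by_def L_norm)
next
  case (convex \<Phi> \<Psi> p)
  let ?a = "\<Phi> T \<xi>" and ?b = "\<Psi> T \<xi>"
  \<comment> \<open>The defect in the convexity of the squared norm.\<close>
  have "p * (norm ?a)\<^sup>2 + (1 - p) * (norm ?b)\<^sup>2 - (norm (p *\<^sub>R ?a + (1 - p) *\<^sub>R ?b))\<^sup>2
      = p * (1 - p) * (norm (?a - ?b))\<^sup>2"
    unfolding power2_norm_eq_inner by (simp add: inner_simps inner_commute algebra_simps power2_eq_square)
  then have "(norm (p *\<^sub>R ?a + (1 - p) *\<^sub>R ?b))\<^sup>2 \<le> p * (norm ?a)\<^sup>2 + (1 - p) * (norm ?b)\<^sup>2"
    using convex.hyps by (smt (verit) mult_nonneg_nonneg zero_le_power2)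
  also have "\<dots> \<le> p * inner (\<Phi> (S o\<^sub>L T) \<xi>) \<xi> + (1 - p) * inner (\<Psi> (S o\<^sub>L T) \<xi>) \<xi>"
    using convex by (intro add_mono mult_left_mono) auto
  finally show ?case by (simp add: blinfun.add_left blinfun.scaleR_left inner_simps)
qed

lemma averaging_mean:
  assumes "finite F" "F \<noteq> {}" "F \<subseteq> H"
  shows "averaging H (\<lambda>T. (1 / card F) *\<^sub>R (\<Sum>t\<in>F. conj_by t T))"
  using assms
proof (induction F rule: finite_ne_induct)
  case (singleton t)
  then show ?case using averaging.conjugate[OF averaging.identity] by simp
next
  case (insert t F)
  define k where "k = real (card F)"
  have k: "k > 0" using insert.hyps by (simp add: k_def card_gt_0_iff)
  \<comment> \<open>The mean over \<open>k + 1\<close> elements gives the new element the weight \<open>1 / (k + 1)\<close>.\<close>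
  have "averaging H (\<lambda>T. (1 / (k + 1)) *\<^sub>R conj_by t T +
      (1 - 1 / (k + 1)) *\<^sub>R ((1 / k) *\<^sub>R (\<Sum>t\<in>F. conj_by t T)))"
    using insert k by (intro averaging.convex averaging.conjugate averaging.identity) (auto simp: k_def)
  moreover have "(1 - 1 / (k + 1)) * (1 / k) = 1 / (k + 1)" using k by (simp add: field_simps)
  moreover have card: "real (card (insert t F)) = k + 1" using insert.hyps by (simp add: k_def)
  ultimately show ?case
    unfolding card using insert.hyps by (simp add: scaleR_add_right)
qed

section \<open>Operators annihilated by averaging\<close>

text \<open>
  Restricted to \<open>A\<close> because different averages commute only on complex-linear operators, see
  \<open>conj_by_conj_by\<close>.
\<close>

definition averaged_null :: "'g set \<Rightarrow> 'g op set"
  where "averaged_null H = {T \<in> A. \<forall>e>0. \<exists>\<Phi>. averaging H \<Phi> \<and> norm (\<Phi> T) < e}"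

lemma averaged_nullD:
  assumes "T \<in> averaged_null H" "e > 0"
  obtains \<Phi> where "averaging H \<Phi>" "norm (\<Phi> T) < e"
  using assms by (auto simp: averaged_null_def)

text \<open>
  If \<open>\<Phi>\<close> makes \<open>S\<close> small and \<open>\<Psi>\<close> makes \<open>T\<close> small, their composition makes both small: averages are
  contractions, and as \<open>H\<close> is commutative they can be applied in either order.
\<close>

lemma averaged_null_add:
  assumes comm: "\<forall>s\<in>H. \<forall>t\<in>H. s + t = t + s"
    and S: "S \<in> averaged_null H" and T: "T \<in> averaged_null H"
  shows "S + T \<in> averaged_null H"
  unfolding averaged_null_def
proof (intro CollectI conjI allI impI)
  have SA: "S \<in> A" and TA: "T \<in> A" using S T by (auto simp: averaged_null_def)
  then show "S + T \<in> A" by (rule A_add)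
  fix e :: real assume "e > 0"
  then obtain \<Phi> \<Psi> where \<Phi>: "averaging H \<Phi>" "norm (\<Phi> S) < e / 2"
    and \<Psi>: "averaging H \<Psi>" "norm (\<Psi> T) < e / 2"
    using averaged_nullD[OF S, of "e / 2"] averaged_nullD[OF T, of "e / 2"]
    by (metis half_gt_zero)
  have "norm (\<Psi> (\<Phi> (S + T))) \<le> norm (\<Psi> (\<Phi> S)) + norm (\<Phi> (\<Psi> T))"
    using norm_triangle_ineq averaging_commute[OF comm \<Phi>(1) \<Psi>(1) TA]
    by (simp add: averaging_add[OF \<Phi>(1)] averaging_add[OF \<Psi>(1)])
  also have "\<dots> < e"
    using averaging_norm[OF \<Psi>(1), of "\<Phi> S"] averaging_norm[OF \<Phi>(1), of "\<Psi> T"] \<Phi>(2) \<Psi>(2)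
    by linarith
  finally show "\<exists>\<Phi>. averaging H \<Phi> \<and> norm (\<Phi> (S + T)) < e"
    using averaging_compose[OF \<Psi>(1) \<Phi>(1)] by blast
qed

lemma averaged_null_op_cscale:
  assumes "T \<in> averaged_null H"
  shows "op_cscale c T \<in> averaged_null H"
  unfolding averaged_null_def
proof (intro CollectI conjI allI impI)
  show "op_cscale c T \<in> A" using assms by (auto simp: averaged_null_def A_scale)
  fix e :: real assume "e > 0"
  then have "e / (cmod c + 1) > 0" by (simp add: add_nonneg_pos)
  then obtain \<Phi> where \<Phi>: "averaging H \<Phi>" "norm (\<Phi> T) < e / (cmod c + 1)"
    using averaged_nullD[OF assms] by blast
  have "norm (\<Phi> (op_cscale c T)) \<le> cmod c * norm (\<Phi> T)"
    by (simp add: averaging_op_cscale[OF \<Phi>(1)] norm_op_cscale)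
  also have "\<dots> \<le> (cmod c + 1) * norm (\<Phi> T)" by (intro mult_right_mono) auto
  also have "\<dots> < e" using \<Phi>(2) by (simp add: pos_less_divide_eq add_nonneg_pos mult.commute)
  finally show "\<exists>\<Phi>. averaging H \<Phi> \<and> norm (\<Phi> (op_cscale c T)) < e" using \<Phi>(1) by blast
qed

lemma averaged_null_zero: "0 \<in> averaged_null H"
proof -
  have "0 \<in> A" using A_diff[OF A_id A_id] by simp
  moreover have "\<exists>\<Phi>. averaging H \<Phi> \<and> norm (\<Phi> 0) < e" if "e > 0" for e
    using that by (intro exI[of _ "\<lambda>T. T"]) (simp add: averaging.identity)
  ultimately show ?thesis by (simp add: averaged_null_def)
qed

lemma averaged_null_scaleR: "T \<in> averaged_null H \<Longrightarrow> r *\<^sub>R T \<in> averaged_null H"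
  using averaged_null_op_cscale[of T H "of_real r"] by (simp add: op_cscale_of_real)

lemma averaged_null_sum:
  assumes "\<forall>s\<in>H. \<forall>t\<in>H. s + t = t + s" "\<And>i. i \<in> F \<Longrightarrow> T i \<in> averaged_null H"
  shows "(\<Sum>i\<in>F. T i) \<in> averaged_null H"
  using assms(2)
  by (induction F rule: infinite_finite_induct) (simp_all add: averaged_null_zero averaged_null_add[OF assms(1)])

lemma averaged_null_limit:
  assumes "\<And>n. f n \<in> averaged_null H" "f \<longlonglongrightarrow> T"
  shows "T \<in> averaged_null H"
  unfolding averaged_null_def
proof (intro CollectI conjI allI impI)
  show "T \<in> A"
  proof (rule closed_sequentially)
    show "closed A" using cstar_subalgebra_A by (simp add: cstar_subalgebra_def)
    show "f n \<in> A" for n using assms(1)[of n] by (simp add: averaged_null_def)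
  qed (rule assms(2))
  fix e :: real assume "e > 0"
  then obtain n where n: "norm (f n - T) < e / 2"
    using LIMSEQ_D[OF assms(2), of "e / 2"] by auto
  obtain \<Phi> where \<Phi>: "averaging H \<Phi>" "norm (\<Phi> (f n)) < e / 2"
    by (rule averaged_nullD[OF assms(1)[of n], of "e / 2"]) (use \<open>e > 0\<close> in simp)
  have "norm (\<Phi> T) \<le> norm (\<Phi> (f n)) + norm (\<Phi> (f n - T))"
    using norm_triangle_ineq4[of "\<Phi> (f n)" "\<Phi> (f n - T)"] by (simp add: averaging_diff[OF \<Phi>(1)])
  then have "norm (\<Phi> T) < e" using \<Phi>(2) n averaging_norm[OF \<Phi>(1), of "f n - T"] by linarith
  then show "\<exists>\<Phi>. averaging H \<Phi> \<and> norm (\<Phi> T) < e" using \<Phi>(1) by blast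
qed

lemma averaged_null_of_anticommuting:
  assumes "T \<in> A" "t \<in> H" "conj_by t T = - T"
  shows "T \<in> averaged_null H"
proof -
  let ?\<Phi> = "\<lambda>T. (1 / 2) *\<^sub>R T + (1 - 1 / 2) *\<^sub>R conj_by t T"
  have "averaging H ?\<Phi>"
    using assms(2) by (intro averaging.intros) auto
  moreover have "norm (?\<Phi> T) = 0"
    using assms(3) by simp
  ultimately have "\<exists>\<Phi>. averaging H \<Phi> \<and> norm (\<Phi> T) < e" if "e > 0" for e
    using that by (intro exI[of _ ?\<Phi>]) simp
  with assms(1) show ?thesis by (simp add: averaged_null_def)
qed

text \<open>
  The conjugates \<open>x\<^sub>t\<close> of \<open>L g\<close> by \<open>t \<in> M\<close> are unitary, and for \<open>s \<noteq> t\<close> the products \<open>x\<^sub>s\<^sup>* x\<^sub>t\<close> are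
  multiples of the operators assumed to be annihilated by averaging.  So the mean \<open>z\<close> of \<open>k\<close> of these
  conjugates behaves like a mean of orthonormal vectors: \<open>z\<^sup>* z\<close> averages to \<open>1/k\<close>, and
  \<open>averaging_Kadison_Schwarz\<close> bounds the average of \<open>z\<close> itself.
\<close>

lemma averaged_null_of_almost_orthogonal:
  assumes comm: "\<forall>s\<in>H. \<forall>t\<in>H. s + t = t + s"
    and M: "infinite M" "M \<subseteq> H"
    and null: "\<And>s t. s \<in> M \<Longrightarrow> t \<in> M \<Longrightarrow> s \<noteq> t \<Longrightarrow>
      L (- (s + g - s) + (t + g - t)) \<in> averaged_null H"
  shows "L g \<in> averaged_null H"
  unfolding averaged_null_def
proof (intro CollectI conjI allI impI)
  show "L g \<in> A" by (rule L_in_A)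
  fix e :: real assume e: "e > 0"
  \<comment> \<open>The final bound is \<open>\<parallel>\<Psi> z\<parallel> \<le> sqrt (2 / k)\<close>: \<open>1/k\<close> from the diagonal terms, and an error
    of at most \<open>1/k\<close> from the others.\<close>
  obtain k :: nat where k: "2 / e\<^sup>2 < k" using reals_Archimedean2 by blast
  have "2 / e\<^sup>2 > 0" using e by simp
  with k have k0: "k > 0" by (metis less_trans of_nat_0_less_iff)
  obtain F where F: "F \<subseteq> M" "finite F" "card F = k"
    using infinite_arbitrarily_large[OF M(1)] by blast
  have "\<forall>t. \<exists>c. cmod c = 1 \<and> conj_by t (L g) = op_cscale c (L (t + g - t))"
    using conj_by_L by blast
  then obtain c where c: "\<And>t. cmod (c t) = 1"
      "\<And>t. conj_by t (L g) = op_cscale (c t) (L (t + g - t))"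
    by metis
  define X where "X t = op_cscale (c t) (L (t + g - t))" for t
  define X' where "X' t = op_cscale (cnj (c t)) (L_inv (t + g - t))" for t
  define \<Phi> where "\<Phi> T = (1 / k) *\<^sub>R (\<Sum>t\<in>F. conj_by t T)" for T
  have \<Phi>: "averaging H \<Phi>"
    unfolding \<Phi>_def[abs_def] using averaging_mean[of F H] F M k0 by fastforce
  define z where "z = (1 / k) *\<^sub>R (\<Sum>t\<in>F. X t)"
  define z' where "z' = (1 / k) *\<^sub>R (\<Sum>t\<in>F. X' t)"
  have \<Phi>_L: "\<Phi> (L g) = z" by (simp add: \<Phi>_def z_def X_def c)
  have adj: "is_adjoint z' z"
    unfolding z_def z'_def X_def X'_def
    by (intro is_adjoint_scaleR is_adjoint_sum is_adjoint_op_cscale L_inv_adjoint)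
  have diag: "X' t o\<^sub>L X t = id_blinfun" for t
  proof -
    have "cnj (c t) * c t = 1" using c(1)[of t] by (simp add: complex_norm_square[symmetric] mult.commute)
    then show ?thesis
      by (simp add: X_def X'_def op_cscale_compose_left op_cscale_compose_right[OF L_inv_complex_linear]
          op_cscale_op_cscale L_inv_L)
  qed
  have offdiag: "X' s o\<^sub>L X t \<in> averaged_null H" if "s \<in> F" "t \<in> F - {s}" for s t
  proof -
    obtain d where "L_inv (s + g - s) o\<^sub>L L (t + g - t) = op_cscale d (L (- (s + g - s) + (t + g - t)))"
      using L_inv_compose by blast
    moreover have "L (- (s + g - s) + (t + g - t)) \<in> averaged_null H"
      by (rule null) (use that F in auto)
    ultimately show ?thesis
      unfolding X_def X'_def op_cscale_compose_left op_cscale_compose_right[OF L_inv_complex_linear]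
      by (intro averaged_null_op_cscale) (simp add: averaged_null_op_cscale)
  qed
  have "z' o\<^sub>L z = (1 / k) *\<^sub>R (1 / k) *\<^sub>R (\<Sum>s\<in>F. \<Sum>t\<in>F. X' s o\<^sub>L X t)"
    unfolding z_def z'_def compose_scaleR_left compose_scaleR_right compose_sum_left
      compose_sum_right by (subst sum.swap) (simp add: scaleR_sum_right)
  also have "(\<Sum>s\<in>F. \<Sum>t\<in>F. X' s o\<^sub>L X t) = (\<Sum>s\<in>F. id_blinfun + (\<Sum>t\<in>F - {s}. X' s o\<^sub>L X t))"
    using F(2) by (intro sum.cong refl) (simp add: sum.remove diag)
  also have "\<dots> = real k *\<^sub>R id_blinfun + (\<Sum>s\<in>F. \<Sum>t\<in>F - {s}. X' s o\<^sub>L X t)"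
    using F by (simp add: sum.distrib sum_constant_scaleR)
  finally have z'z: "(z' o\<^sub>L z) - (1 / k) *\<^sub>R id_blinfun
      = (1 / k) *\<^sub>R (1 / k) *\<^sub>R (\<Sum>s\<in>F. \<Sum>t\<in>F - {s}. X' s o\<^sub>L X t)"
    using k0 by (simp add: scaleR_add_right)
  have "(z' o\<^sub>L z) - (1 / k) *\<^sub>R id_blinfun \<in> averaged_null H"
    unfolding z'z by (intro averaged_null_scaleR averaged_null_sum[OF comm] offdiag)
  then obtain \<Psi> where \<Psi>: "averaging H \<Psi>"
      "norm (\<Psi> ((z' o\<^sub>L z) - (1 / k) *\<^sub>R id_blinfun)) < 1 / k"
    by (rule averaged_nullD[of _ H "1 / k"]) (use k0 in simp)
  have "norm (\<Psi> (z' o\<^sub>L z)) \<le> norm (\<Psi> (z' o\<^sub>L z) - (1 / k) *\<^sub>R id_blinfun) + norm ((1 / k) *\<^sub>R id_blinfun :: 'g op)"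
    using norm_triangle_ineq[of "\<Psi> (z' o\<^sub>L z) - (1 / k) *\<^sub>R id_blinfun" "(1 / k) *\<^sub>R id_blinfun"] by simp
  also have "\<dots> \<le> 1 / k + 1 / k * 1"
    using \<Psi>(2) k0 norm_blinfun_id_le[where 'a="'g ell2"]
    by (intro add_mono)
      (simp_all add: averaging_diff[OF \<Psi>(1)] averaging_scaleR[OF \<Psi>(1)] averaging_id[OF \<Psi>(1)] divide_right_mono)
  finally have small: "norm (\<Psi> (z' o\<^sub>L z)) \<le> 2 / k" by simp
  have "norm (\<Psi> z) \<le> sqrt (2 / real k)"
  proof (rule norm_blinfun_bound)
    fix \<xi>
    have "(norm (\<Psi> z \<xi>))\<^sup>2 \<le> inner (\<Psi> (z' o\<^sub>L z) \<xi>) \<xi>"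
      by (rule averaging_Kadison_Schwarz[OF \<Psi>(1) adj])
    also have "\<dots> \<le> norm (\<Psi> (z' o\<^sub>L z) \<xi>) * norm \<xi>" by (rule norm_cauchy_schwarz)
    also have "\<dots> \<le> norm (\<Psi> (z' o\<^sub>L z)) * norm \<xi> * norm \<xi>"
      by (intro mult_right_mono norm_blinfun) simp
    also have "\<dots> \<le> 2 / k * norm \<xi> * norm \<xi>" by (intro mult_right_mono small) auto
    also have "\<dots> = (sqrt (2 / real k) * norm \<xi>)\<^sup>2"
      by (simp add: power_mult_distrib) (simp add: power2_eq_square)
    finally show "norm (\<Psi> z \<xi>) \<le> sqrt (2 / real k) * norm \<xi>"
      by (rule power2_le_imp_le) simp
  qed simp
  moreover have "sqrt (2 / real k) < e"
  proof (rule real_less_lsqrt)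
    show "2 / k < e\<^sup>2" using k k0 e by (simp add: field_simps)
  qed (use e in auto)
  ultimately show "\<exists>\<Phi>. averaging H \<Phi> \<and> norm (\<Phi> (L g)) < e"
    using averaging_compose[OF \<Psi>(1) \<Phi>] \<Phi>_L by (intro exI[of _ "\<lambda>T. \<Psi> (\<Phi> T)"]) auto
qed

text \<open>
  By the closure properties of \<open>averaged_null\<close> it suffices to look at generators, where the operator is
  \<open>0\<close> for \<open>g = 0\<close> and \<open>L g\<close> otherwise.
\<close>

lemma averaged_null_minus_trace:
  assumes comm: "\<forall>s\<in>H. \<forall>t\<in>H. s + t = t + s"
    and null: "\<And>g. g \<noteq> 0 \<Longrightarrow> L g \<in> averaged_null H"
    and T: "T \<in> A"
  shows "T - op_cscale (canonical_trace T) id_blinfun \<in> averaged_null H"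
proof -
  let ?N = "\<lambda>T. T - op_cscale (canonical_trace T) id_blinfun"
  have lin: "canonical_trace (S + T) = canonical_trace S + canonical_trace T"
      "canonical_trace (op_cscale c T) = c * canonical_trace T" for S T c
    by (simp_all add: canonical_trace_def blinfun.add_left cinner_add_left op_cscale_apply cinner_cscale_left)
  have op_cscale_sum: "op_cscale (c + d) S = op_cscale c S + op_cscale d S" for c d and S :: "'g op"
    by (intro blinfun_eqI ell2_eqI)
      (simp add: op_cscale_apply blinfun.add_left plus_ell2.rep_eq cscale.rep_eq algebra_simps)
  show ?thesis
    using T
  proof (induction T rule: reduced_induct)
    case (monomial c g)
    show ?case
    proof (cases "g = 0")
      case True
      then show ?thesis using averaged_null_zero canonical_trace_L[of 0] by (simp add: lin L_zero)
    next
      case False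
      have "op_cscale 0 id_blinfun = (0 :: 'g op)" using op_cscale_of_real[of 0 id_blinfun] by simp
      with False show ?thesis
        using averaged_null_op_cscale[OF null[OF False], of c] by (simp add: lin canonical_trace_L)
    qed
  next
    case (add S T)
    have "?N (S + T) = ?N S + ?N T" by (simp add: lin op_cscale_sum)
    then show ?case using averaged_null_add[OF comm add.IH] by (simp only:)
  next
    case (limit f T)
    \<comment> \<open>A decomposition into real multiples of fixed operators, which shows that the scalar operator
      depends continuously on \<open>c\<close>.\<close>
    define J :: "'g op" where "J = op_cscale \<i> id_blinfun"
    have eq: "op_cscale c (id_blinfun :: 'g op) = Re c *\<^sub>R id_blinfun + Im c *\<^sub>R J"
      for c :: complex
    proof -
      have "op_cscale (of_real (Re c) + of_real (Im c) * \<i>) (id_blinfun :: 'g op)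
          = op_cscale (of_real (Re c)) id_blinfun + op_cscale (of_real (Im c)) J"
        by (simp only: J_def op_cscale_sum op_cscale_op_cscale)
      moreover have "of_real (Re c) + of_real (Im c) * \<i> = c" by (simp add: complex_eq_iff)
      ultimately show ?thesis by (simp only: op_cscale_of_real)
    qed
    have "(\<lambda>n. canonical_trace (f n)) \<longlonglongrightarrow> canonical_trace T"
      unfolding canonical_trace_def
      by (intro tendsto_cinner tendsto_const tendsto_blinfun_apply limit.hyps)
    then have "(\<lambda>n. ?N (f n)) \<longlonglongrightarrow> ?N T"
      unfolding eq by (intro tendsto_intros limit.hyps)
    then show ?case by (rule averaged_null_limit[rotated]) (rule limit.IH)
  qed
qed

text \<open>
  Tracial states do not change under averaging, so they vanish on \<open>averaged_null H\<close> and are determined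
  by \<open>averaged_null_minus_trace\<close>.  A nonzero closed ideal contains an element of canonical trace \<open>1\<close> by
  faithfulness; its averages stay in the ideal and come arbitrarily close to the identity.
\<close>

theorem unique_trace_and_simple_if_averaged_null:
  assumes comm: "\<forall>s\<in>H. \<forall>t\<in>H. s + t = t + s"
    and null: "\<And>g. g \<noteq> 0 \<Longrightarrow> L g \<in> averaged_null H"
  shows "unique_trace_property \<sigma>" and "cstar_simple \<sigma>"
proof -
  have Dixmier: "T - op_cscale (canonical_trace T) id_blinfun \<in> averaged_null H" if "T \<in> A" for T
    by (rule averaged_null_minus_trace[OF comm null that])
  show "unique_trace_property \<sigma>"
    unfolding unique_trace_property_def unique_tracial_state_def
  proof (intro exI conjI allI impI ballI)
    show "tracial_state A canonical_trace" by (rule tracial_state_canonical_trace)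
    fix \<tau> T assume \<tau>: "tracial_state A \<tau>" and T: "T \<in> A"
    let ?x = "T - op_cscale (canonical_trace T) id_blinfun"
    have x: "?x \<in> A" by (intro A_diff T A_scale A_id)
    have "cmod (\<tau> ?x) < e" if e: "e > 0" for e
    proof -
      obtain \<Phi> where \<Phi>: "averaging H \<Phi>" "norm (\<Phi> ?x) < e / 4"
        by (rule averaged_nullD[OF Dixmier[OF T], of "e / 4"]) (use e in simp)
      have "cmod (\<tau> (\<Phi> ?x)) \<le> 4 * norm (\<Phi> ?x)"
        by (rule tracial_state_bounded[OF cstar_subalgebra_A A_id \<tau>
              averaging_in_ideal[OF closed_ideal_A \<Phi>(1) x]])
      then show ?thesis using \<Phi>(2) trace_averaging[OF \<tau> \<Phi>(1) x] by simp
    qed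
    then have "\<tau> ?x = 0" by (metis less_irrefl zero_less_norm_iff)
    moreover have "\<tau> (?x + op_cscale (canonical_trace T) id_blinfun)
        = \<tau> ?x + \<tau> (op_cscale (canonical_trace T) id_blinfun)"
      using \<tau> x A_scale[OF A_id] unfolding tracial_state_def by blast
    moreover have "\<tau> (op_cscale (canonical_trace T) id_blinfun) = canonical_trace T"
      using \<tau> A_id unfolding tracial_state_def by simp
    ultimately show "\<tau> T = canonical_trace T" by simp
  qed
  show "cstar_simple \<sigma>"
    unfolding cstar_simple_def simple_cstar_def
  proof (intro conjI allI impI)
    have "id_blinfun \<noteq> (0 :: 'g op)"
    proof
      assume "id_blinfun = (0 :: 'g op)"
      then have "delta (0 :: 'g) = 0" by (metis blinfun_apply_id_blinfun id_apply zero_blinfun.rep_eq)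
      then show False using norm_delta[of "0 :: 'g"] by simp
    qed
    then show "A \<noteq> {0}" using A_id by blast
    fix I assume I: "closed_ideal I A"
    show "I = {0} \<or> I = A"
    proof (cases "I = {0}")
      case False
      have "0 \<in> I" using I by (simp add: closed_ideal_def op_csubspace_def)
      with False obtain T where T: "T \<in> I" "T \<noteq> 0" by blast
      then have TA: "T \<in> A" using I by (auto simp: closed_ideal_def)
      then obtain S where S: "S \<in> A" "is_adjoint S T"
        using cstar_subalgebra_A by (auto simp: cstar_subalgebra_def)
      define c where "c = canonical_trace (S o\<^sub>L T)"
      define x where "x = op_cscale (1 / c) (S o\<^sub>L T)"
      have c: "c \<noteq> 0" unfolding c_def by (rule canonical_trace_faithful[OF TA T(2) S])
      have x: "x \<in> I" using I S T unfolding x_def by (simp add: closed_ideal_def op_csubspace_def)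
      have "canonical_trace x = 1"
        using c by (simp add: x_def c_def canonical_trace_def op_cscale_apply cinner_cscale_left)
      then have null_x: "x - id_blinfun \<in> averaged_null H"
        using Dixmier[of x] x I by (auto simp: closed_ideal_def)
      have "\<forall>n::nat. \<exists>y\<in>I. norm (y - id_blinfun) < 1 / Suc n"
      proof
        fix n :: nat
        obtain \<Phi> where \<Phi>: "averaging H \<Phi>" "norm (\<Phi> (x - id_blinfun)) < 1 / Suc n"
          by (rule averaged_nullD[OF null_x, of "1 / Suc n"]) simp
        then show "\<exists>y\<in>I. norm (y - id_blinfun) < 1 / Suc n"
          using averaging_in_ideal[OF I \<Phi>(1) x]
          by (intro bexI[of _ "\<Phi> x"]) (simp_all add: averaging_diff[OF \<Phi>(1)] averaging_id[OF \<Phi>(1)])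
      qed
      then obtain y where y: "\<And>n::nat. y n \<in> I" "\<And>n. norm (y n - id_blinfun) < 1 / Suc n"
        by metis
      have "(\<lambda>n. y n - id_blinfun) \<longlonglongrightarrow> 0"
        by (rule Lim_null_comparison[OF _ LIMSEQ_inverse_real_of_nat])
          (use y(2) in \<open>auto intro!: always_eventually less_imp_le simp: inverse_eq_divide\<close>)
      then have "y \<longlonglongrightarrow> id_blinfun" by (rule LIM_zero_cancel)
      then have "id_blinfun \<in> I"
        using closed_sequentially[of I y id_blinfun] y(1) I by (simp add: closed_ideal_def)
      then have "A \<subseteq> I" using I unfolding closed_ideal_def by (metis compose_id(1) subsetI)
      then show ?thesis using I by (auto simp: closed_ideal_def)
    qed simp
  qed
qed

end

section \<open>Lamp configurations\<close>

lemma bit_configuration_self_add [simp]: "a + a = (0 :: int \<Rightarrow>\<^sub>0 bit)"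
proof (rule poly_mapping_eqI)
  fix k
  have "x + x = 0" for x :: bit by (cases x) simp_all
  then show "Poly_Mapping.lookup (a + a) k = Poly_Mapping.lookup 0 k"
    by (simp only: lookup_add lookup_zero)
qed

lemma bit_configuration_uminus: "- a = (a :: int \<Rightarrow>\<^sub>0 bit)"
  by (rule minus_unique) simp

lemma bit_configuration_swap:
  assumes "a + b = c + (d :: int \<Rightarrow>\<^sub>0 bit)"
  shows "b + d = a + c"
proof -
  have "b + d = a + (a + b) + d" by (simp flip: add.assoc)
  also have "\<dots> = a + c" unfolding assms by (simp add: add.assoc)
  finally show ?thesis .
qed

lemma keys_shift: "Poly_Mapping.keys (shift n a) = (\<lambda>k. k + n) ` Poly_Mapping.keys a"
proof (rule set_eqI)
  fix k
  show "k \<in> Poly_Mapping.keys (shift n a) \<longleftrightarrow> k \<in> (\<lambda>k. k + n) ` Poly_Mapping.keys a"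
    by (auto simp: in_keys_iff shift.rep_eq image_iff intro!: bexI[of _ "k - n"])
qed

text \<open>
  A nonempty finite set of lamps is not invariant under a translation, as its largest element would move.
\<close>

lemma shift_fixed_imp_zero:
  assumes "shift n a = a" "n \<noteq> 0"
  shows "a = 0"
proof -
  have pos: "a = 0" if fixed: "shift n a = a" and n: "n > 0" for n
  proof (rule ccontr)
    assume "a \<noteq> 0"
    then have ne: "Poly_Mapping.keys a \<noteq> {}" by simp
    have "Max (Poly_Mapping.keys a) + n \<in> Poly_Mapping.keys (shift n a)"
      unfolding keys_shift using Max_in[OF finite_keys ne] by blast
    then show False using Max_ge[OF finite_keys, of _ a] n fixed by fastforce
  qed
  show ?thesis
  proof (cases "n > 0")
    case False
    have "shift (- n) a = shift (- n) (shift n a)" using assms(1) by simp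
    then show ?thesis using pos[of "- n"] False assms(2) by simp
  qed (use pos assms in blast)
qed

text \<open>
  A configuration is determined by its support, since the only nonzero value is \<open>1\<close>.
\<close>

lemma finite_configurations_within:
  assumes "finite K"
  shows "finite {a :: int \<Rightarrow>\<^sub>0 bit. Poly_Mapping.keys a \<subseteq> K}"
proof (rule inj_on_finite[of Poly_Mapping.keys])
  show "inj_on Poly_Mapping.keys {a :: int \<Rightarrow>\<^sub>0 bit. Poly_Mapping.keys a \<subseteq> K}"
  proof (rule inj_onI, rule poly_mapping_eqI)
    fix a b :: "int \<Rightarrow>\<^sub>0 bit" and k
    assume "Poly_Mapping.keys a = Poly_Mapping.keys b"
    then have "Poly_Mapping.lookup a k = 0 \<longleftrightarrow> Poly_Mapping.lookup b k = 0"
      by (metis in_keys_iff)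
    then show "Poly_Mapping.lookup a k = Poly_Mapping.lookup b k"
      by (metis bit_not_zero_iff)
  qed
  show "Poly_Mapping.keys ` {a :: int \<Rightarrow>\<^sub>0 bit. Poly_Mapping.keys a \<subseteq> K} \<subseteq> Pow K" by auto
  show "finite (Pow K)" using assms by simp
qed

section \<open>Recurrences and periodicity\<close>

text \<open>
  The recurrence expresses the value at either end of an interval of length \<open>Max S - Min S\<close> by the
  others, so the window where \<open>h\<close> is trivial can be moved by one in both directions.
\<close>

lemma recurrence_window:
  fixes h :: "int \<Rightarrow> complex"
  assumes S: "finite S" "S \<noteq> {}"
    and rec: "\<And>k. (\<Prod>j\<in>S. h (k - j)) = 1"
    and window: "\<And>y. x \<le> y \<Longrightarrow> y < x + (Max S - Min S) \<Longrightarrow> h y = 1"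
  shows "h z = 1"
proof -
  define a where "a = Min S"
  define b where "b = Max S"
  have ab: "a \<in> S" "b \<in> S" and bounds: "\<And>j. j \<in> S \<Longrightarrow> a \<le> j \<and> j \<le> b"
    using S by (auto simp: a_def b_def)
  \<comment> \<open>\<open>P x\<close>: the window that starts at \<open>x\<close> is trivial.\<close>
  define P where "P x \<longleftrightarrow> (\<forall>y. x \<le> y \<and> y < x + (b - a) \<longrightarrow> h y = 1)" for x
  have extend: "h (k - i) = 1" if "i \<in> S" "\<And>j. j \<in> S \<Longrightarrow> j \<noteq> i \<Longrightarrow> h (k - j) = 1" for i k
  proof -
    have "(\<Prod>j\<in>S. h (k - j)) = h (k - i) * (\<Prod>j\<in>S - {i}. h (k - j))"
      using S(1) that(1) by (rule prod.remove)
    also have "(\<Prod>j\<in>S - {i}. h (k - j)) = 1" using that(2) by (intro prod.neutral) auto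
    finally show ?thesis using rec by simp
  qed
  have right: "h (x + (b - a)) = 1" if "P x" for x
  proof -
    have "h ((x + b) - a) = 1"
    proof (rule extend[OF ab(1)])
      fix j assume "j \<in> S" "j \<noteq> a"
      then show "h (x + b - j) = 1" using that bounds[of j] by (auto simp: P_def)
    qed
    then show ?thesis by (simp add: algebra_simps)
  qed
  have left: "h (x - 1) = 1" if "P x" for x
  proof -
    have "h ((x - 1 + b) - b) = 1"
    proof (rule extend[OF ab(2)])
      fix j assume "j \<in> S" "j \<noteq> b"
      then show "h (x - 1 + b - j) = 1" using that bounds[of j] by (auto simp: P_def)
    qed
    then show ?thesis by simp
  qed
  have all: "P y" for y
  proof (induction y rule: int_induct[of _ x])
    case base
    show ?case using window by (auto simp: P_def a_def b_def)
  next
    case (step1 i)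
    show ?case
      unfolding P_def
    proof (intro allI impI)
      fix y assume y: "i + 1 \<le> y \<and> y < i + 1 + (b - a)"
      show "h y = 1"
      proof (cases "y = i + (b - a)")
        case True
        then show ?thesis using right[OF step1(2)] by simp
      next
        case False
        then show ?thesis using y step1(2) by (auto simp: P_def)
      qed
    qed
  next
    case (step2 i)
    show ?case
      unfolding P_def
    proof (intro allI impI)
      fix y assume y: "i - 1 \<le> y \<and> y < i - 1 + (b - a)"
      show "h y = 1"
      proof (cases "y = i - 1")
        case True
        then show ?thesis using left[OF step2(2)] by simp
      next
        case False
        then show ?thesis using y step2(2) by (auto simp: P_def)
      qed
    qed
  qed
  show ?thesis using right[OF all, of "z - (b - a)"] by simp
qed

text \<open>
  Only finitely many sign patterns occur on windows of length \<open>Max S - Min S\<close>, so two of them agree, say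
  at distance \<open>m\<close>.  The quotient of \<open>f\<close> and its translate by \<open>m\<close> satisfies the same recurrence and is
  trivial on a window, hence everywhere.  Signs are their own inverses, so the quotient is written as a
  product.
\<close>

lemma periodic_if_recurrence:
  fixes f :: "int \<Rightarrow> complex"
  assumes sign: "\<And>d. f d \<in> {-1, 1}"
    and S: "finite S" "S \<noteq> {}"
    and rec: "\<And>k. (\<Prod>j\<in>S. f (k - j)) = 1"
  shows "\<exists>m\<ge>1. \<forall>d. f (d + m) = f d"
proof -
  define W where "W x = {i \<in> {0..<Max S - Min S}. f (int x + i) = 1}" for x
  have "\<not> inj W"
  proof
    assume "inj W"
    moreover have "range W \<subseteq> Pow {0..<Max S - Min S}" by (auto simp: W_def)
    ultimately have "finite (UNIV :: nat set)" by (rule inj_on_finite) simp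
    then show False by simp
  qed
  then obtain x y where xy: "x < y" "W x = W y"
    unfolding inj_def by (metis linorder_neqE_nat)
  define m where "m = int y - int x"
  define h where "h z = f z * f (z + m)" for z
  have h1: "h z = 1 \<longleftrightarrow> f (z + m) = f z" for z
    using sign[of z] sign[of "z + m"] by (auto simp: h_def)
  have "h z = 1" for z
  proof (rule recurrence_window[OF S])
    fix k
    have "(\<Prod>j\<in>S. h (k - j)) = (\<Prod>j\<in>S. f (k - j)) * (\<Prod>j\<in>S. f (k + m - j))"
      by (simp add: h_def prod.distrib algebra_simps)
    then show "(\<Prod>j\<in>S. h (k - j)) = 1" by (simp add: rec)
  next
    fix z assume z: "int x \<le> z" "z < int x + (Max S - Min S)"
    then have "z - int x \<in> W x \<longleftrightarrow> f z = 1" "z - int x \<in> W y \<longleftrightarrow> f (z + m) = 1"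
      by (auto simp: W_def m_def algebra_simps)
    then show "h z = 1" unfolding h1 using xy(2) sign[of z] sign[of "z + m"] by auto
  qed
  then show ?thesis using h1 xy(1) by (intro exI[of _ m]) (auto simp: m_def)
qed

section \<open>The commutation form\<close>

locale diagonal_signs =
  fixes \<mu> :: "int \<Rightarrow> int \<Rightarrow> complex"
  assumes one: "\<And>j k. j \<ge> k \<Longrightarrow> \<mu> j k = 1"
    and sign: "\<And>j k. j < k \<Longrightarrow> \<mu> j k \<in> {-1, 1}"
    and diagonal: "\<And>j k n. j < k \<Longrightarrow> \<mu> j k = \<mu> (j + n) (k + n)"
begin

sublocale twisted_group "lamplighter_cocycle \<mu>"
proof
  show "two_cocycle (lamplighter_cocycle \<mu>)"
    by (rule two_cocycle_lamplighter_cocycle) (rule sign, assumption, rule diagonal)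
qed

lemma \<mu>_eq: "\<mu> j k = \<mu> 0 (k - j)"
  using one[of k j] one[of "k - j" 0] diagonal[of j k "- j"] by (cases "j < k") auto

lemma \<mu>_sign: "\<mu> j k = 1 \<or> \<mu> j k = - 1"
  using one[of k j] sign[of j k] by (cases "j < k") auto

lemma \<mu>_square: "\<mu> j k * \<mu> j k = 1"
  using \<mu>_sign[of j k] by auto

lemma cocycle_prod:
  "lamp_cocycle \<mu> s t = (\<Prod>(j, k)\<in>Poly_Mapping.keys s \<times> Poly_Mapping.keys t. \<mu> 0 (k - j))"
proof -
  have keys: "Poly_Mapping.lookup s j = 1 \<longleftrightarrow> j \<in> Poly_Mapping.keys s" for s :: "int \<Rightarrow>\<^sub>0 bit" and j
    by (simp add: in_keys_iff)
  show ?thesis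
    unfolding lamp_cocycle_def keys
    by (intro prod.mono_neutral_cong_left) (auto simp: \<mu>_eq[symmetric] intro!: one)
qed

lemma cocycle_add:
  "lamp_cocycle \<mu> (s + s') t = lamp_cocycle \<mu> s t * lamp_cocycle \<mu> s' t"
  "lamp_cocycle \<mu> t (s + s') = lamp_cocycle \<mu> t s * lamp_cocycle \<mu> t s'"
  by (rule lamp_cocycle_bicharacter[OF sign], assumption)+

lemma cocycle_shift: "lamp_cocycle \<mu> (shift n s) (shift n t) = lamp_cocycle \<mu> s t"
  by (rule lamp_cocycle_shift) (rule diagonal)

lemma cocycle_sign: "lamp_cocycle \<mu> s t = 1 \<or> lamp_cocycle \<mu> s t = - 1"
proof -
  have "lamp_cocycle \<mu> s t * lamp_cocycle \<mu> s t = 1"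
    unfolding cocycle_prod prod.distrib[symmetric] case_prod_unfold
    by (intro prod.neutral) (simp add: \<mu>_square)
  then show ?thesis by (simp add: square_eq_1_iff)
qed

text \<open>
  The commutation sign of two lamps at distance \<open>d\<close>: at most one of the two factors differs from \<open>1\<close>.
\<close>

definition interaction :: "int \<Rightarrow> complex"
  where "interaction d = \<mu> 0 d * \<mu> 0 (- d)"

lemma interaction_sign: "interaction d \<in> {-1, 1}"
  using \<mu>_sign[of 0 d] \<mu>_sign[of 0 "- d"] by (auto simp: interaction_def)

lemma interaction_pos: "d \<ge> 0 \<Longrightarrow> interaction d = \<mu> 0 d"
  by (simp add: interaction_def one)

lemma interaction_zero: "interaction 0 = 1"
  by (simp add: interaction_def one)

lemma interaction_minus: "interaction (- d) = interaction d"
  by (simp add: interaction_def mult.commute)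

lemma interaction_mem:
  "interaction d = - 1 \<longleftrightarrow> d \<in> neg_diagonals \<mu> \<union> uminus ` neg_diagonals \<mu>"
proof -
  have "d \<in> uminus ` neg_diagonals \<mu> \<longleftrightarrow> - d \<in> neg_diagonals \<mu>"
    by (metis (no_types) image_iff minus_minus)
  moreover have "interaction d = - 1 \<longleftrightarrow> d \<in> neg_diagonals \<mu>" if "d > 0"
    using that by (simp add: interaction_pos neg_diagonals_def)
  moreover have "interaction d = - 1 \<longleftrightarrow> - d \<in> neg_diagonals \<mu>" if "d < 0"
    using that interaction_pos[of "- d"] by (simp add: interaction_minus neg_diagonals_def)
  ultimately show ?thesis
    by (cases d "0 :: int" rule: linorder_cases) (auto simp: interaction_zero neg_diagonals_def)
qed

lemma periodic_iff_interaction: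
  "periodic_diagonals (neg_diagonals \<mu>) \<longleftrightarrow> (\<exists>m\<ge>1. \<forall>d. interaction (d + m) = interaction d)"
proof -
  define Y where "Y = neg_diagonals \<mu> \<union> uminus ` neg_diagonals \<mu>"
  have Y: "d \<in> Y \<longleftrightarrow> interaction d = - 1" for d by (simp add: Y_def interaction_mem)
  have "(\<lambda>y. m + y) ` Y = Y \<longleftrightarrow> (\<forall>d. interaction (d + m) = interaction d)" for m
  proof -
    have "(\<lambda>y. m + y) ` Y = Y \<longleftrightarrow> (\<forall>d. d + m \<in> (\<lambda>y. m + y) ` Y \<longleftrightarrow> d + m \<in> Y)"
      by (metis diff_add_cancel set_eq_iff)
    also have "\<dots> \<longleftrightarrow> (\<forall>d. d \<in> Y \<longleftrightarrow> d + m \<in> Y)" by (auto simp: image_iff add.commute)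
    also have "\<dots> \<longleftrightarrow> (\<forall>d. interaction (d + m) = interaction d)"
      unfolding Y using interaction_sign by (metis insertE singletonD)
    finally show ?thesis .
  qed
  then show ?thesis by (simp add: periodic_diagonals_def Let_def Y_def)
qed

lemma commutation_prod:
  "lamp_cocycle \<mu> s t * lamp_cocycle \<mu> t s
    = (\<Prod>(j, k)\<in>Poly_Mapping.keys s \<times> Poly_Mapping.keys t. interaction (k - j))"
proof -
  have "lamp_cocycle \<mu> t s
      = (\<Prod>(j, k)\<in>Poly_Mapping.keys s \<times> Poly_Mapping.keys t. \<mu> 0 (j - k))"
    unfolding cocycle_prod
    by (rule prod.reindex_bij_witness[of _ "\<lambda>(j, k). (k, j)" "\<lambda>(j, k). (k, j)"]) auto
  then show ?thesis
    by (simp add: cocycle_prod prod.distrib[symmetric] interaction_def case_prod_unfold)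
qed

section \<open>Nonperiodic matrices\<close>

text \<open>
  If \<open>s\<close> commuted with every single lamp, the interaction signs would satisfy a recurrence with
  coefficient set the support of \<open>s\<close>, and would be periodic.
\<close>

lemma nonperiodic_anticommuting_lamp:
  assumes "\<not> periodic_diagonals (neg_diagonals \<mu>)" "s \<noteq> 0"
  shows "\<exists>t. lamp_cocycle \<mu> t s * lamp_cocycle \<mu> s t = - 1"
proof (rule ccontr)
  assume contra: "\<not> ?thesis"
  have "(\<Prod>j\<in>Poly_Mapping.keys s. interaction (k - j)) = 1" for k
  proof -
    have keys: "Poly_Mapping.keys (Poly_Mapping.single k (1 :: bit)) = {k}" by simp
    have "lamp_cocycle \<mu> s (Poly_Mapping.single k 1) * lamp_cocycle \<mu> (Poly_Mapping.single k 1) s = 1"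
      using contra cocycle_sign[of s "Poly_Mapping.single k 1"]
        cocycle_sign[of "Poly_Mapping.single k 1" s]
      by (metis mult.commute mult_1 mult_minus1 minus_minus)
    then show ?thesis
      unfolding commutation_prod keys by (simp add: prod.cartesian_product[symmetric])
  qed
  then have "\<exists>m\<ge>1. \<forall>d. interaction (d + m) = interaction d"
    using assms(2) by (intro periodic_if_recurrence[OF interaction_sign finite_keys]) auto
  then show False using assms(1) periodic_iff_interaction by simp
qed

text \<open>
  Base elements are averaged to \<open>0\<close> by an anticommuting lamp.  Conjugating \<open>g\<close> of nonzero position by
  different base elements gives different elements of the same position, because no nonempty
  configuration is fixed by a translation; the quotient of two of them is a nontrivial base element.
\<close>

lemma nonperiodic_averaged_null:
  assumes nonper: "\<not> periodic_diagonals (neg_diagonals \<mu>)" and g: "g \<noteq> 0"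
  shows "L g \<in> averaged_null {g. pos g = 0}"
proof -
  have base: "L h \<in> averaged_null {g. pos g = 0}" if h: "h \<noteq> 0" "pos h = 0" for h
  proof -
    have "lamps h \<noteq> 0" using h by (cases h) (auto simp: zero_lamplighter_def)
    then obtain t where t: "lamp_cocycle \<mu> t (lamps h) * lamp_cocycle \<mu> (lamps h) t = - 1"
      using nonperiodic_anticommuting_lamp[OF nonper] by blast
    show ?thesis
    proof (rule averaged_null_of_anticommuting[OF L_in_A, of "Lamp t 0"])
      have "cnj (lamp_cocycle \<mu> (lamps h) t) = lamp_cocycle \<mu> (lamps h) t"
        using cocycle_sign[of "lamps h" t] by auto
      moreover have "Lamp t 0 + h = h + Lamp t 0"
        using h(2) by (simp add: plus_lamplighter_def add.commute)
      ultimately have "conj_by (Lamp t 0) (L h) = op_cscale (of_real (- 1)) (L h)"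
        using t h(2) by (simp add: conj_by_L_commuting lamplighter_cocycle_def)
      then show "conj_by (Lamp t 0) (L h) = - L h"
        by (simp only: op_cscale_of_real) simp
    qed simp
  qed
  show ?thesis
  proof (cases "pos g = 0")
    case False
    show ?thesis
    proof (rule averaged_null_of_almost_orthogonal[where M="{g. pos g = 0}"])
      show "\<forall>s\<in>{g. pos g = 0}. \<forall>t\<in>{g. pos g = 0}. s + t = t + s"
        by (auto simp: plus_lamplighter_def add.commute)
      have "inj (\<lambda>k. Lamp (Poly_Mapping.single k 1) 0)"
        by (auto simp: inj_def dest!: arg_cong[of _ _ Poly_Mapping.keys])
      then have "infinite (range (\<lambda>k. Lamp (Poly_Mapping.single k 1) 0))"
        using range_inj_infinite infinite_UNIV_int finite_imageD by blast
      then show "infinite {g. pos g = 0}" by (rule infinite_super[rotated]) auto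
      fix s t assume st: "s \<in> {g. pos g = 0}" "t \<in> {g. pos g = 0}" "s \<noteq> t"
      show "L (- (s + g - s) + (t + g - t)) \<in> averaged_null {g. pos g = 0}"
      proof (rule base)
        show "pos (- (s + g - s) + (t + g - t)) = 0"
          using st by (simp add: plus_lamplighter_def uminus_lamplighter_def minus_lamplighter_def)
        show "- (s + g - s) + (t + g - t) \<noteq> 0"
        proof
          assume "- (s + g - s) + (t + g - t) = 0"
          then have "s + g - s = t + g - t" by (simp add: add_eq_0_iff)
          then have "lamps s + shift (pos g) (lamps s) = lamps t + shift (pos g) (lamps t)"
            using st by (simp add: plus_lamplighter_def uminus_lamplighter_def minus_lamplighter_def
                bit_configuration_uminus algebra_simps)
          then have "shift (pos g) (lamps s + lamps t) = lamps s + lamps t"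
            unfolding shift_add by (rule bit_configuration_swap)
          then have "lamps s + lamps t = 0" using False by (rule shift_fixed_imp_zero)
          then have "lamps s = lamps t" by (simp add: add_eq_0_iff bit_configuration_uminus)
          then show False using st by (cases s; cases t) auto
        qed
      qed
    qed auto
  qed (use base g in blast)
qed

section \<open>Periodic matrices\<close>

text \<open>
  The cocycle of the matrix cut off at distance \<open>m\<close> yields the quadratic form that trivializes the
  restriction of the original cocycle in \<open>periodic_second_trace\<close>.
\<close>

lemma short_range_diagonal_signs: "diagonal_signs (\<lambda>j k. if k - j < m then \<mu> j k else 1)"
proof
  fix j k n :: int
  show "j < k \<Longrightarrow> (if k - j < m then \<mu> j k else 1)
      = (if k + n - (j + n) < m then \<mu> (j + n) (k + n) else 1)"
    using diagonal[of j k n] by simp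
qed (use one sign in auto)

text \<open>
  The elements \<open>e a\<close> commute with the whole base by periodicity (\<open>e_central\<close>), but the restriction of the
  cocycle to them is not trivial.  By \<open>e_cocycle\<close> it equals \<open>(a, b) \<mapsto> c'(a, b) c'(b, a)\<close> for the bicharacter
  \<open>c'\<close> of the matrix cut off at distance \<open>m\<close>, that is, the polarization of the quadratic form
  \<open>Q a = c'(a, a)\<close>.  Therefore \<open>Q\<close> is a character of the twisted algebra of these elements, invariant
  under shifts because \<open>c'\<close> is constant along diagonals.
\<close>

lemma periodic_second_trace:
  assumes per: "\<And>d. interaction (d + m) = interaction d" and m: "m \<ge> 1"
  shows "\<exists>\<tau> r. tracial_state A \<tau> \<and> r \<noteq> 0 \<and> \<tau> (L r) \<noteq> 0"
proof -
  define \<mu>' where "\<mu>' j k = (if k - j < m then \<mu> j k else 1)" for j k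
  interpret short: diagonal_signs \<mu>'
    unfolding \<mu>'_def[abs_def] by (rule short_range_diagonal_signs)
  let ?c = "lamp_cocycle \<mu>" and ?c' = "lamp_cocycle \<mu>'"
  define e where "e a = a + shift m a" for a
  define Q where "Q a = ?c' a a" for a
  have e_add: "e (a + b) = e a + e b" for a b by (simp add: e_def shift_add algebra_simps)
  have e_zero: "e 0 = 0" by (simp add: e_def)
  have e_shift: "e (shift n a) = shift n (e a)" for n a by (simp add: e_def shift_add add.commute)
  have e_inj: "a = b" if "e a = e b" for a b
  proof -
    have "e (a + b) = 0" using that by (simp add: e_add)
    then have "shift m (a + b) = - (a + b)" by (simp only: e_def add_eq_0_iff)
    then have "a + b = 0" using m by (intro shift_fixed_imp_zero[of m]) (simp_all only: bit_configuration_uminus)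
    then show ?thesis by (metis bit_configuration_uminus add_eq_0_iff)
  qed
  have per': "interaction (d - m) = interaction d" for d
    using per[of "d - m"] by simp
  \<comment> \<open>For \<open>d \<ge> m\<close> the two signs on the left agree by periodicity, for \<open>d \<le> - m\<close> both are \<open>1\<close>, and in
    between only the first one counts and equals \<open>interaction d\<close>.\<close>
  have pointwise: "\<mu> 0 (d + m) * \<mu> 0 (d - m) = \<mu>' 0 d * \<mu>' 0 (- d)" for d
  proof -
    have *: "\<mu> 0 i = (if i \<ge> 0 then interaction i else 1)" for i
      by (simp add: interaction_pos one)
    have m1: "interaction m = 1" using per[of 0] by (simp add: interaction_zero)
    have sq: "interaction d * interaction d = 1" using interaction_sign[of d] by auto
    consider "d \<ge> m" | "\<bar>d\<bar> < m" | "d \<le> - m" by linarith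
    then show ?thesis
    proof cases
      case 1
      then show ?thesis using m sq by (simp add: \<mu>'_def one * per per')
    next
      case 2
      then show ?thesis using m
        by (auto simp: \<mu>'_def * per per' interaction_minus interaction_zero)
    next
      case 3
      have "d + m = 0 \<Longrightarrow> d = - m" by simp
      with 3 show ?thesis using m by (auto simp: \<mu>'_def one)
    qed
  qed
  have e_cocycle: "?c (e a) (e b) = ?c' a b * ?c' b a" for a b
  proof -
    let ?K = "Poly_Mapping.keys a \<times> Poly_Mapping.keys b"
    have "?c (e a) (e b) = (?c a b * ?c a b) * (?c a (shift m b) * ?c (shift m a) b)"
      by (simp add: e_def cocycle_add cocycle_shift mult_ac)
    also have "\<dots> = ?c a (shift m b) * ?c (shift m a) b" using cocycle_sign[of a b] by auto
    also have "?c a (shift m b) = (\<Prod>(j, k)\<in>?K. \<mu> 0 (k - j + m))"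
      unfolding cocycle_prod keys_shift
      by (rule prod.reindex_bij_witness[of _ "\<lambda>(j, k). (j, k + m)" "\<lambda>(j, k). (j, k - m)"])
        (auto simp: algebra_simps)
    also have "?c (shift m a) b = (\<Prod>(j, k)\<in>?K. \<mu> 0 (k - j - m))"
      unfolding cocycle_prod keys_shift
      by (rule prod.reindex_bij_witness[of _ "\<lambda>(j, k). (j + m, k)" "\<lambda>(j, k). (j - m, k)"])
        (auto simp: algebra_simps)
    finally show ?thesis
      unfolding short.commutation_prod short.interaction_def prod.distrib[symmetric]
      by (simp add: case_prod_unfold pointwise prod.distrib[symmetric])
  qed
  have e_central: "?c (e a) t = ?c t (e a)" for a t
  proof -
    let ?K = "Poly_Mapping.keys a \<times> Poly_Mapping.keys t"
    have "?c (shift m a) t * ?c t (shift m a) = (\<Prod>(j, k)\<in>?K. interaction (k - j - m))"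
      unfolding commutation_prod keys_shift
      by (rule prod.reindex_bij_witness[of _ "\<lambda>(j, k). (j + m, k)" "\<lambda>(j, k). (j - m, k)"])
        (auto simp: algebra_simps)
    also have "\<dots> = ?c a t * ?c t a" by (simp add: commutation_prod per')
    finally have "?c (e a) t * ?c t (e a) = (?c a t * ?c a t) * (?c t a * ?c t a)"
      by (simp add: e_def cocycle_add mult_ac)
    also have "\<dots> = 1" using cocycle_sign[of a t] cocycle_sign[of t a] by auto
    finally show ?thesis using cocycle_sign[of "e a" t] cocycle_sign[of t "e a"] by auto
  qed
  define \<phi> where "\<phi> g = Q (THE a. e a = lamps g)" for g
  have \<phi>_e: "\<phi> (Lamp (e a) 0) = Q a" for a
  proof -
    have "(THE b. e b = e a) = a" using e_inj by blast
    then show ?thesis by (simp add: \<phi>_def)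
  qed
  \<comment> \<open>Finite subgroups exhausting the elements \<open>e a\<close>.\<close>
  define F where "F N = (\<lambda>a. Lamp (e a) 0) ` {a. Poly_Mapping.keys a \<subseteq> {- int N..int N}}" for N
  have F_Un: "g \<in> (\<Union>N. F N) \<longleftrightarrow> (\<exists>a. g = Lamp (e a) 0)" for g
  proof
    assume "\<exists>a. g = Lamp (e a) 0"
    then obtain a where a: "g = Lamp (e a) 0" by blast
    define N where "N = nat (\<Sum>k\<in>Poly_Mapping.keys a. \<bar>k\<bar>)"
    have "\<bar>k\<bar> \<le> int N" if "k \<in> Poly_Mapping.keys a" for k
      using member_le_sum[OF that, of abs] by (simp add: N_def sum_nonneg)
    then have "Poly_Mapping.keys a \<subseteq> {- int N..int N}" by (force simp: abs_le_iff)
    then show "g \<in> (\<Union>N. F N)" using a by (auto simp: F_def)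
  qed (auto simp: F_def)
  define \<omega> where "\<omega> g = (if g \<in> (\<Union>N. F N) then \<phi> g else 0)" for g
  \<comment> \<open>\<open>h + g\<close> is the conjugate of \<open>g + h\<close> by \<open>h\<close>, which for \<open>g + h = e a\<close> is a translate of \<open>e a\<close>.
    The cocycle values agree because \<open>e a\<close> commutes with the base also in the twisted algebra.\<close>
  have swap: "\<exists>b. h + g = Lamp (e b) 0 \<and> Q b = Q a \<and>
      lamplighter_cocycle \<mu> g h = lamplighter_cocycle \<mu> h g"
    if "g + h = Lamp (e a) 0" for g h a
  proof -
    define t where "t = shift (pos g) (lamps h)"
    have pos: "pos h = - pos g" and lamps: "lamps g + t = e a"
      using that by (auto simp: plus_lamplighter_def t_def)
    have h: "lamps h = shift (- pos g) t" by (simp add: t_def)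
    have g: "lamps g = e a + t"
      unfolding lamps[symmetric] by (simp add: add.assoc)
    have "h + g = Lamp (e (shift (- pos g) a)) 0"
      using pos lamps by (simp add: plus_lamplighter_def h e_shift shift_add[symmetric] add.commute)
    moreover have "Q (shift (- pos g) a) = Q a" by (simp add: Q_def short.cocycle_shift)
    moreover have "lamplighter_cocycle \<mu> h g = ?c t (lamps g)"
      unfolding lamplighter_cocycle_def h pos by (rule cocycle_shift)
    then have "lamplighter_cocycle \<mu> g h = lamplighter_cocycle \<mu> h g"
      by (simp add: lamplighter_cocycle_def t_def[symmetric] g cocycle_add e_central)
    ultimately show ?thesis by blast
  qed
  have "\<exists>\<tau>. tracial_state A \<tau> \<and> (\<forall>g. \<tau> (L g) = (if g \<in> (\<Union>N. F N) then \<phi> g else 0))"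
  proof (rule tracial_state_of_character)
    show "finite (F N)" for N unfolding F_def by (intro finite_imageI finite_configurations_within) simp
    show "0 \<in> F N" for N
      unfolding F_def by (rule image_eqI[of _ _ 0]) (simp_all add: e_zero zero_lamplighter_def)
    show "g + h \<in> F N" if gh: "g \<in> F N" "h \<in> F N" for N g h
    proof -
      obtain a b where "g = Lamp (e a) 0" "h = Lamp (e b) 0"
          "Poly_Mapping.keys a \<subseteq> {- int N..int N}" "Poly_Mapping.keys b \<subseteq> {- int N..int N}"
        using gh unfolding F_def by blast
      then show ?thesis
        using keys_add[of a b] unfolding F_def
        by (intro image_eqI[of _ _ "a + b"]) (auto simp: plus_lamplighter_def e_add)
    qed
    show "- g \<in> F N" if "g \<in> F N" for N g
      using that by (auto simp: F_def uminus_lamplighter_def bit_configuration_uminus)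
    show "incseq F"
      unfolding incseq_def F_def by (intro allI impI image_mono) force
    show "cmod (\<phi> g) = 1" if "g \<in> F N" for N g
      using that short.cocycle_sign by (auto simp: F_def \<phi>_e Q_def) (metis norm_minus_cancel norm_one)
    show "lamplighter_cocycle \<mu> g h * \<phi> (g + h) = \<phi> g * \<phi> h" if gh: "g \<in> F N" "h \<in> F N" for N g h
    proof -
      obtain a b where ab: "g = Lamp (e a) 0" "h = Lamp (e b) 0" using gh by (auto simp: F_def)
      have sum: "g + h = Lamp (e (a + b)) 0" by (simp add: ab plus_lamplighter_def e_add)
      define q where "q = ?c' a b * ?c' b a"
      have "lamplighter_cocycle \<mu> g h = q"
        by (simp add: lamplighter_cocycle_def ab e_cocycle q_def)
      moreover have "\<phi> (g + h) = Q a * Q b * q"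
        unfolding sum \<phi>_e by (simp add: Q_def q_def short.cocycle_add mult_ac)
      moreover have "q * q = 1"
        using short.cocycle_sign[of a b] short.cocycle_sign[of b a] by (auto simp: q_def)
      ultimately have "lamplighter_cocycle \<mu> g h * \<phi> (g + h) = Q a * Q b"
        by (simp add: mult_ac)
      then show ?thesis by (simp add: ab \<phi>_e)
    qed
    have "lamplighter_cocycle \<mu> g h * \<omega> (g + h) = lamplighter_cocycle \<mu> h g * \<omega> (h + g)" for g h
    proof (cases "g + h \<in> (\<Union>N. F N)")
      case True
      then obtain a where a: "g + h = Lamp (e a) 0" using F_Un by blast
      then obtain b where b: "h + g = Lamp (e b) 0" "Q b = Q a"
          "lamplighter_cocycle \<mu> g h = lamplighter_cocycle \<mu> h g"
        using swap by blast
      have "\<omega> (Lamp (e c) 0) = Q c" for c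
        using F_Un[of "Lamp (e c) 0"] unfolding \<omega>_def \<phi>_e by (auto simp del: UN_iff)
      then show ?thesis unfolding a b by (simp only: b(2))
    next
      case False
      then have "h + g \<notin> (\<Union>N. F N)" using swap unfolding F_Un by blast
      with False show ?thesis by (simp add: \<omega>_def)
    qed
    then show "lamplighter_cocycle \<mu> g h * (if g + h \<in> (\<Union>N. F N) then \<phi> (g + h) else 0)
        = lamplighter_cocycle \<mu> h g * (if h + g \<in> (\<Union>N. F N) then \<phi> (h + g) else 0)" for g h
      by (simp only: \<omega>_def)
  qed
  then obtain \<tau> where \<tau>: "tracial_state A \<tau>" "\<And>g. \<tau> (L g) = (if g \<in> (\<Union>N. F N) then \<phi> g else 0)"
    by blast
  define a where "a = Poly_Mapping.single (0 :: int) (1 :: bit)"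
  have "a \<noteq> 0" by (simp add: a_def)
  then have "Lamp (e a) 0 \<noteq> 0" using e_inj[of a 0] by (auto simp: zero_lamplighter_def e_zero)
  moreover have "Lamp (e a) 0 \<in> (\<Union>N. F N)" using F_Un by blast
  then have "\<tau> (L (Lamp (e a) 0)) = Q a" by (simp only: \<tau>(2) if_True \<phi>_e)
  then have "\<tau> (L (Lamp (e a) 0)) \<noteq> 0" using short.cocycle_sign[of a a] by (auto simp: Q_def)
  ultimately show ?thesis using \<tau>(1) by blast
qed

end

theorem proposition5p12:
  fixes \<mu> :: "int \<Rightarrow> int \<Rightarrow> complex"
  assumes "\<And>j k. j \<ge> k \<Longrightarrow> \<mu> j k = 1"
    and "\<And>j k. j < k \<Longrightarrow> \<mu> j k \<in> {-1, 1}"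
    and "\<And>j k n. j < k \<Longrightarrow> \<mu> j k = \<mu> (j + n) (k + n)"
  shows "(unique_trace_property (lamplighter_cocycle \<mu>) \<longleftrightarrow> \<not> periodic_diagonals (neg_diagonals \<mu>)) \<and>
    (\<not> periodic_diagonals (neg_diagonals \<mu>) \<longrightarrow> cstar_simple (lamplighter_cocycle \<mu>))"
proof -
  interpret diagonal_signs \<mu>
    by unfold_locales (fact assms)+
  have comm: "\<forall>s\<in>{g. pos g = 0}. \<forall>t\<in>{g. pos g = 0}. s + t = t + s"
    by (auto simp: plus_lamplighter_def add.commute)
  have "unique_trace_property (lamplighter_cocycle \<mu>)" "cstar_simple (lamplighter_cocycle \<mu>)"
    if "\<not> periodic_diagonals (neg_diagonals \<mu>)"
    by (rule unique_trace_and_simple_if_averaged_null[OF comm nonperiodic_averaged_null[OF that]],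
        assumption)+
  moreover have "\<not> unique_trace_property (lamplighter_cocycle \<mu>)"
    if periodic: "periodic_diagonals (neg_diagonals \<mu>)"
  proof
    assume unique: "unique_trace_property (lamplighter_cocycle \<mu>)"
    obtain m where "m \<ge> 1" "\<And>d. interaction (d + m) = interaction d"
      using periodic periodic_iff_interaction by auto
    then obtain \<tau> r where \<tau>: "tracial_state A \<tau>" "r \<noteq> 0" "\<tau> (L r) \<noteq> 0"
      using periodic_second_trace by blast
    have "\<tau> (L r) = canonical_trace (L r)"
      using unique \<tau>(1) tracial_state_canonical_trace L_in_A
      unfolding unique_trace_property_def unique_tracial_state_def by metis
    then show False using \<tau>(2,3) by (simp add: canonical_trace_L)
  qed
  ultimately show ?thesis by blast
qed

end
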